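(* Let $n\ge 2$, let $G$ be a group with $G\cong C_2\oplus C_2\oplus C_{2n}$, and let $H$ be a transfer Krull monoid over $G$. Then $\Delta_{\rho}(H)=\{1\}$.
   Context: $C_m$ is a cyclic group of order $m$. $\mathbb N$ denotes the positive integers, $\mathbb N_0=\mathbb N\cup\{0\}$. A monoid is an associative semigroup with unit element; $H^{\times}$ is the group of invertible elements of a monoid $H$. $H$ is unit-cancellative if $au=a$ or $ua=a$ (with $a,u\in H$) implies $u\in H^{\times}$. An atom is an element $u\in H\setminus H^{\times}$ such that $u=ab$ with $a,b\in H$ implies $a\in H^\times$ or $b\in H^\times$; $\mathcal A(H)$ is the set of atoms; $H$ is atomic if every non-unit is a finite product of atoms. For $a\in H\setminus H^\times$, $\mathsf L_H(a)=\mathsf L(a)$ is the set of all $k\in\mathbb N$ such that $a$ is a product of $k$ atoms; $\mathsf L(a)=\{0\}$ for $a\in H^\times$; $\mathcal L(H)=\{\mathsf L(a)\mid a\in H\}$. For nonempty $L\subset\mathbb N$ put $\rho(L)=\sup L/\min L$, and $\rho(\{0\})=1$; $\rho(H)=\sup\{\rho(L)\mid L\in\mathcal L(H)\}$. A set $L\subset\mathbb Z$ is an AAP with difference $d\in\mathbb N$ and length $\ell\in\mathbb N_0$ if $L=y+(L'\cup\{0,d,\ldots,\ell d\}\cup L'')\subset y+d\mathbb Z$ for some $y\in\mathbb Z$ and finite sets $L',L''$ with $L'\subset[-M,-1]$ and $L''\subset \ell d+[1,M]$ for some $M\in\mathbb N_0$. $\Delta_\rho(H)$ is the set of all $d\in\mathbb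 N$ such that for every $k\in\mathbb N$ there is some $L_k\in\mathcal L(H)$ which is an AAP with difference $d$, length at least $k$, and $\rho(L_k)=\rho(H)$. For an additive abelian group $G$, $\mathcal F(G)$ is the free abelian monoid with basis $G$ (written multiplicatively, elements $S=g_1\cdots g_\ell$), and $\mathcal B(G)=\{g_1\cdots g_\ell\in\mathcal F(G)\mid g_1+\ldots+g_\ell=0\}$ is the monoid of zero-sum sequences. A monoid homomorphism $\theta\colon H\to B$ between atomic monoids is a weak transfer homomorphism if (T1) $B=B^\times\theta(H)B^\times$ and $\theta^{-1}(B^\times)=H^\times$; (WT2) whenever $a\in H$, $n\in\mathbb N$, $v_1,\ldots,v_n\in\mathcal A(B)$ and $\theta(a)=v_1\cdots v_n$, there are $u_1,\ldots,u_n\in\mathcal A(H)$ and a permutation $\tau$ of $\{1,\ldots,n\}$ with $a=u_1\cdots u_n$ and $\theta(u_i)\in B^\times v_{\tau(i)}B^\times$ for all $i$. A transfer Krull monoid over $G$ is an atomic unit-cancellative monoid $H$ admitting a weak transfer homomorphism $\theta\colon H\to\mathcal B(G)$. *)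

theory Defs
  imports
    "HOL-Algebra.Algebra"
    "HOL-Combinatorics.Permutations"
    "HOL-Library.Extended_Real"
    "HOL-Library.Multiset"
begin

section \<open>Atoms and atomic monoids\<close>

text \<open>
  Monoids need not be commutative. The library notion \<^term>\<open>irreducible\<close> is based on one-sided
  divisibility, so atoms are defined directly.
\<close>

definition atoms :: "('a, 'b) monoid_scheme \<Rightarrow> 'a set" where
  "atoms H = {u \<in> carrier H - Units H.
     \<forall>a \<in> carrier H. \<forall>b \<in> carrier H. u = a \<otimes>\<^bsub>H\<^esub> b \<longrightarrow> a \<in> Units H \<or> b \<in> Units H}"

definition list_prod :: "('a, 'b) monoid_scheme \<Rightarrow> 'a list \<Rightarrow> 'a" where
  "list_prod H us = foldr (\<lambda>x y. x \<otimes>\<^bsub>H\<^esub> y) us \<one>\<^bsub>H\<^esub>"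

locale atomic_monoid = monoid H for H (structure) +
  assumes atomic:
    "a \<in> carrier H - Units H \<Longrightarrow> \<exists>us. us \<noteq> [] \<and> set us \<subseteq> atoms H \<and> list_prod H us = a"

definition unit_cancellative :: "('a, 'b) monoid_scheme \<Rightarrow> bool" where
  "unit_cancellative H \<longleftrightarrow>
     (\<forall>a \<in> carrier H. \<forall>u \<in> carrier H. a \<otimes>\<^bsub>H\<^esub> u = a \<or> u \<otimes>\<^bsub>H\<^esub> a = a \<longrightarrow> u \<in> Units H)"


section \<open>Sets of lengths and elasticity\<close>

definition length_set :: "('a, 'b) monoid_scheme \<Rightarrow> 'a \<Rightarrow> nat set" where
  "length_set H a =
     (if a \<in> Units H then {0}
      else {k. k \<ge> 1 \<and> (\<exists>us. length us = k \<and> set us \<subseteq> atoms H \<and> list_prod H us = a)})"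

definition length_system :: "('a, 'b) monoid_scheme \<Rightarrow> nat set set" where
  "length_system H = length_set H ` carrier H"

text \<open>
  Only meaningful for \<open>L = {0}\<close> and for nonempty \<open>L\<close> with \<open>0 \<notin> L\<close>; then \<open>Inf L\<close> is the minimum
  of \<open>L\<close>. The value is \<open>\<infinity>\<close> if \<open>L\<close> is infinite.
\<close>

definition set_elasticity :: "nat set \<Rightarrow> ereal" where
  "set_elasticity L =
     (if L = {0} then 1 else (SUP k\<in>L. ereal (real k)) / ereal (real (Inf L)))"

definition elasticity :: "('a, 'b) monoid_scheme \<Rightarrow> ereal" where
  "elasticity H = (SUP L \<in> length_system H. set_elasticity L)"


section \<open>Almost arithmetical progressions and \<open>\<Delta>\<^sub>\<rho>\<close>\<close>

definition is_AAP :: "nat \<Rightarrow> nat \<Rightarrow> int set \<Rightarrow> bool" where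
  "is_AAP d l L \<longleftrightarrow> d \<ge> 1 \<and>
     (\<exists>(y::int) L' L'' (M::nat).
        finite L' \<and> finite L'' \<and>
        L' \<subseteq> {- int M .. -1} \<and>
        L'' \<subseteq> {int l * int d + 1 .. int l * int d + int M} \<and>
        L = (\<lambda>z. y + z) ` (L' \<union> {int i * int d | i. i \<le> l} \<union> L'') \<and>
        L \<subseteq> {y + int d * z | z. True})"

definition Delta_rho :: "('a, 'b) monoid_scheme \<Rightarrow> nat set" where
  "Delta_rho H = {d. d \<ge> 1 \<and>
     (\<forall>k\<ge>1. \<exists>L \<in> length_system H. \<exists>l\<ge>k.
        is_AAP d l (int ` L) \<and> set_elasticity L = elasticity H)}"


section \<open>Zero-sum sequences and transfer Krull monoids\<close>

text \<open>
  A sequence over \<open>G\<close>, i.e. an element of the free abelian monoid with basis \<open>G\<close>, is a finite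
  multiset of elements of \<open>carrier G\<close>, and concatenation is multiset union. Groups in
  \<open>HOL-Algebra\<close> are written multiplicatively, so the sum of a sequence is a product in \<open>G\<close>, taken
  over the distinct elements with their multiplicities.
\<close>

definition seq_sum :: "('g, 'b) monoid_scheme \<Rightarrow> 'g multiset \<Rightarrow> 'g" where
  "seq_sum G S = finprod G (\<lambda>g. g [^]\<^bsub>G\<^esub> count S g) (set_mset S)"

definition zero_sum_monoid :: "('g, 'b) monoid_scheme \<Rightarrow> 'g multiset monoid" where
  "zero_sum_monoid G =
     \<lparr>carrier = {S. set_mset S \<subseteq> carrier G \<and> seq_sum G S = \<one>\<^bsub>G\<^esub>},
      monoid.mult = (\<lambda>S T. S + T),
      one = {#}\<rparr>"

locale weak_transfer_hom =
  H: atomic_monoid H + B: atomic_monoid B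
  for H :: "('a, 'c) monoid_scheme" and B :: "('b, 'd) monoid_scheme" +
  fixes \<theta> :: "'a \<Rightarrow> 'b"
  assumes hom: "\<theta> \<in> hom H B"
    and hom_one: "\<theta> \<one>\<^bsub>H\<^esub> = \<one>\<^bsub>B\<^esub>"
    and T1_surj: "carrier B = Units B <#>\<^bsub>B\<^esub> (\<theta> ` carrier H) <#>\<^bsub>B\<^esub> Units B"
    and T1_units: "{a \<in> carrier H. \<theta> a \<in> Units B} = Units H"
    and WT2: "\<lbrakk>a \<in> carrier H; vs \<noteq> []; set vs \<subseteq> atoms B; \<theta> a = list_prod B vs\<rbrakk> \<Longrightarrow>
      \<exists>us \<tau>. length us = length vs \<and> set us \<subseteq> atoms H \<and> a = list_prod H us \<and>
        \<tau> permutes {..<length vs} \<and>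
        (\<forall>i<length vs. \<theta> (us ! i) \<in> Units B <#>\<^bsub>B\<^esub> {vs ! \<tau> i} <#>\<^bsub>B\<^esub> Units B)"

definition transfer_Krull_monoid ::
    "('a, 'c) monoid_scheme \<Rightarrow> ('g, 'b) monoid_scheme \<Rightarrow> bool" where
  "transfer_Krull_monoid H G \<longleftrightarrow> atomic_monoid H \<and> unit_cancellative H \<and>
     (\<exists>\<theta>. weak_transfer_hom H (zero_sum_monoid G) \<theta>)"

end

theory Submission
  imports Defs "HOL-Library.Z2" "HOL-Library.Product_Plus"
begin

text \<open>
  A weak transfer homomorphism preserves sets of lengths, so \<open>H\<close> may be replaced by the monoid of
  zero-sum sequences over \<open>G\<close>, whose atoms are the minimal zero-sum sequences.

  The first task is to understand the long atoms. Consider the quotient map of \<open>G\<close> onto \<open>G/2G \<cong>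
  C\<^sub>2\<^sup>3\<close>, whose kernel \<open>2G\<close> has \<open>n\<close> elements. If an atom \<open>U\<close> is cut into blocks whose sums lie in
  the kernel, then the partial sums of the blocks are distinct, so there are at most \<open>n\<close> blocks;
  and if there are exactly \<open>n\<close> blocks, then cutting the union of two of them anew into two blocks
  always yields the same sums (\<open>number_of_blocks_le\<close>, \<open>common_block_sum\<close>). Now cut \<open>U\<close> into as
  many pairs of elements of equal class as possible. The remaining elements have distinct classes
  with sum zero, and there are only eight classes; counting shows that \<open>U\<close> has at most \<open>2 n + 2\<close>
  elements and that, for length \<open>2 n + 2\<close>, exactly four elements remain, whose classes are nonzero
  (\<open>long_minimal_zero_sum_split\<close>). Exchanging a pair with parts of these four elements determines
  the pair (\<open>pair_in_long_minimal_zero_sum\<close>), and three shapes of \<open>U\<close> are left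
  (\<open>long_minimal_zero_sum_structure\<close>).

  Each shape yields explicit zero-sum sequences that divide two copies of \<open>U (-U)\<close> and have
  factorizations of different lengths, and a positive integer dividing all these differences of
  lengths is \<open>1\<close> (\<open>long_minimal_zero_sum_difference\<close>).

  Since atoms have length at most \<open>2 n + 2\<close>, all elasticities are at most \<open>n + 1\<close>. A sequence \<open>A\<close>
  of elasticity \<open>n + 1\<close> is both a product of atoms of length \<open>2 n + 2\<close> and a product of atoms that
  equal their own negatives. If its minimal length is large, then some atom \<open>U\<close> occurs four times
  in the first product, and by the symmetry of \<open>A\<close> two copies of \<open>U (-U)\<close> divide \<open>A\<close>. Hence \<open>d =
  1\<close> for all \<open>d\<close> in \<open>\<Delta>\<^sub>\<rho>\<close> (\<open>extremal_lengths_difference\<close>). Conversely, for one concrete atom \<open>U\<close>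
  of length \<open>2 n + 2\<close> the lengths of \<open>U (-U)\<close> include \<open>2\<close>, \<open>2 n + 1\<close> and \<open>2 n + 2\<close>, so the powers
  of \<open>U (-U)\<close> have elasticity \<open>n + 1\<close> and contain arbitrarily long intervals of lengths
  (\<open>lengths_long_seq_powers\<close>).
\<close>

section \<open>Minimal zero-sum sequences and factorization lengths\<close>

definition minimal_zero_sum :: "'a::ab_group_add multiset \<Rightarrow> bool" where
  "minimal_zero_sum V \<longleftrightarrow> V \<noteq> {#} \<and> sum_mset V = 0 \<and>
     (\<forall>W. W \<subseteq># V \<longrightarrow> sum_mset W = 0 \<longrightarrow> W = {#} \<or> W = V)"

text \<open>
  Factorizations are multisets of minimal zero-sum sequences, since concatenation is commutative.
  All factors are contained in \<open>A\<close>, so the result does not depend on a subgroup to which the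
  elements of \<open>A\<close> are confined.
\<close>

definition factorization_lengths :: "'a::ab_group_add multiset \<Rightarrow> nat set" where
  "factorization_lengths A =
     {size \<V> | \<V>. (\<forall>V \<in># \<V>. minimal_zero_sum V) \<and> \<Sum>\<^sub># \<V> = A}"

abbreviation neg_seq :: "'a::ab_group_add multiset \<Rightarrow> 'a multiset" where
  "neg_seq \<equiv> image_mset uminus"

lemma factorization_lengthsI:
  assumes "\<forall>V \<in># \<V>. minimal_zero_sum V"
  shows "size \<V> \<in> factorization_lengths (\<Sum>\<^sub># \<V>)"
  using assms by (auto simp: factorization_lengths_def)

lemma factorization_lengthsE:
  assumes "k \<in> factorization_lengths A"
  obtains \<V> where "size \<V> = k" "\<forall>V \<in># \<V>. minimal_zero_sum V" "\<Sum>\<^sub># \<V> = A"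
  using assms by (auto simp: factorization_lengths_def)

lemma sum_mset_neg_seq: "sum_mset (neg_seq S) = - sum_mset (S :: 'a::ab_group_add multiset)"
  by (induction S) auto

lemma sum_replicate_mset_add:
  "sum_mset (replicate_mset (i + j) g) =
    sum_mset (replicate_mset i g) + sum_mset (replicate_mset j (g :: 'a::ab_group_add))"
  by (induction i) (auto simp: add.assoc)

lemma minimal_zero_sum_sub:
  assumes "minimal_zero_sum U" "W \<subset># U" "W \<noteq> {#}"
  shows "sum_mset W \<noteq> 0"
  using assms unfolding minimal_zero_sum_def by (auto simp: subset_mset_def)

lemma minimal_zero_sum_neg:
  assumes "minimal_zero_sum U"
  shows "minimal_zero_sum (neg_seq U)"
  unfolding minimal_zero_sum_def
proof (intro conjI allI impI)
  show "neg_seq U \<noteq> {#}" "sum_mset (neg_seq U) = 0"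
    using assms by (auto simp: minimal_zero_sum_def sum_mset_neg_seq)
next
  fix W assume W: "W \<subseteq># neg_seq U" "sum_mset W = 0"
  have "neg_seq W \<subseteq># neg_seq (neg_seq U)" using W(1) by (rule image_mset_subseteq_mono)
  then have "neg_seq W \<subseteq># U" by (simp add: image_mset.compositionality comp_def)
  then have "neg_seq W = {#} \<or> neg_seq W = U"
    using assms W by (auto simp: minimal_zero_sum_def sum_mset_neg_seq)
  moreover have "W = neg_seq (neg_seq W)" by (simp add: image_mset.compositionality comp_def)
  ultimately show "W = {#} \<or> W = neg_seq U" by auto
qed

lemma minimal_zero_sum_pair:
  assumes "g \<noteq> (0::'a::ab_group_add)"
  shows "minimal_zero_sum {#g, -g#}"
  unfolding minimal_zero_sum_def
proof (intro conjI allI impI)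
  fix W assume W: "W \<subseteq># {#g, -g#}" "sum_mset W = 0"
  then have "size W \<le> 2" using size_mset_mono by fastforce
  then consider "size W = 0" | "size W = 1" | "size W = 2" by linarith
  then show "W = {#} \<or> W = {#g, -g#}"
  proof cases
    case 2
    then obtain x where "W = {#x#}" using size_1_singleton_mset by blast
    with W assms show ?thesis by auto
  next
    case 3
    then have "W = {#g, -g#}" using W(1)
      by (metis mset_subset_size size_add_mset size_empty nat_less_le numeral_2_eq_2 subset_mset.le_imp_less_or_eq)
    then show ?thesis ..
  qed auto
qed auto

lemma minimal_zero_sum_length_1:
  "minimal_zero_sum V \<Longrightarrow> 1 \<in> factorization_lengths V"
  using factorization_lengthsI[of "{#V#}"] by auto

lemma factorization_lengths_add:
  assumes "k \<in> factorization_lengths A" "l \<in> factorization_lengths B"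
  shows "k + l \<in> factorization_lengths (A + B)"
proof -
  obtain \<V> where V: "size \<V> = k" "\<forall>V \<in># \<V>. minimal_zero_sum V" "\<Sum>\<^sub># \<V> = A"
    using assms(1) by (rule factorization_lengthsE)
  obtain \<W> where W: "size \<W> = l" "\<forall>V \<in># \<W>. minimal_zero_sum V" "\<Sum>\<^sub># \<W> = B"
    using assms(2) by (rule factorization_lengthsE)
  show ?thesis using factorization_lengthsI[of "\<V> + \<W>"] V W by auto
qed

lemma factorization_lengths_empty: "0 \<in> factorization_lengths {#}"
  using factorization_lengthsI[of "{#}"] by auto

lemma factorization_lengths_repeat:
  assumes "k \<in> factorization_lengths A"
  shows "m * k \<in> factorization_lengths (repeat_mset m A)"
proof (induction m)
  case (Suc m)
  then show ?case using factorization_lengths_add[OF assms Suc] by simp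
qed (simp add: factorization_lengths_empty)

lemma factorization_exists:
  assumes "sum_mset A = (0::'a::ab_group_add)"
  shows "\<exists>k. k \<in> factorization_lengths A"
  using assms
proof (induction A rule: measure_induct_rule[of size])
  case (less A)
  show ?case
  proof (cases "A = {#} \<or> minimal_zero_sum A")
    case True
    then show ?thesis using factorization_lengths_empty minimal_zero_sum_length_1 by blast
  next
    case False
    then obtain W where W: "W \<subseteq># A" "sum_mset W = 0" "W \<noteq> {#}" "W \<noteq> A"
      using less.prems unfolding minimal_zero_sum_def by auto
    then obtain W' where A: "A = W + W'" by (metis mset_subset_eq_exists_conv)
    have "W' \<noteq> {#}" "sum_mset W' = 0" using W A less.prems by auto
    then have "size W < size A" "size W' < size A" using W A by (auto simp: nonempty_has_size)
    with less.IH[of W] less.IH[of W'] W \<open>sum_mset W' = 0\<close>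
    obtain k l where "k \<in> factorization_lengths W" "l \<in> factorization_lengths W'" by auto
    then show ?thesis unfolding A using factorization_lengths_add by blast
  qed
qed

lemma factorization_lengths_zero_sum:
  assumes "k \<in> factorization_lengths A"
  shows "sum_mset A = 0"
proof -
  obtain \<V> where V: "\<forall>V \<in># \<V>. minimal_zero_sum V" "\<Sum>\<^sub># \<V> = A"
    using assms by (rule factorization_lengthsE)
  have "(\<forall>V \<in># \<V>. minimal_zero_sum V) \<Longrightarrow> sum_mset (\<Sum>\<^sub># \<V>) = 0"
    by (induction \<V>) (auto simp: minimal_zero_sum_def)
  then show ?thesis using V by auto
qed

lemma factorization_lengths_le_size:
  assumes "k \<in> factorization_lengths A"
  shows "k \<le> size A"
proof -
  obtain \<V> where V: "size \<V> = k" "\<forall>V \<in># \<V>. minimal_zero_sum V" "\<Sum>\<^sub># \<V> = A"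
    using assms by (rule factorization_lengthsE)
  have "(\<forall>V \<in># \<V>. minimal_zero_sum V) \<Longrightarrow> size \<V> \<le> size (\<Sum>\<^sub># \<V>)"
  proof (induction \<V>)
    case (add V \<V>)
    then have "size V \<ge> 1" by (auto simp: minimal_zero_sum_def Suc_le_eq nonempty_has_size)
    with add show ?case by auto
  qed auto
  then show ?thesis using V by auto
qed

lemma finite_factorization_lengths: "finite (factorization_lengths A)"
  using factorization_lengths_le_size by (metis finite_nat_set_iff_bounded_le)

lemma zero_in_factorization_lengths_iff: "0 \<in> factorization_lengths A \<longleftrightarrow> A = {#}"
  using factorization_lengths_empty by (auto elim: factorization_lengthsE)

lemma factorization_lengths_pairs:
  assumes "0 \<notin># S"
  shows "size S \<in> factorization_lengths (S + neg_seq S)"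
  using assms
proof (induction S)
  case (add g S)
  then have "1 + size S \<in> factorization_lengths ({#g, -g#} + (S + neg_seq S))"
    by (intro factorization_lengths_add minimal_zero_sum_length_1 minimal_zero_sum_pair) auto
  then show ?case by (simp add: add_mset_commute)
qed (simp add: factorization_lengths_empty)

lemma zero_in_minimal_zero_sum:
  assumes "minimal_zero_sum V" "0 \<in># V"
  shows "V = {#0#}"
proof -
  have "{#0#} \<subseteq># V" using assms(2) by simp
  then show ?thesis using assms(1) unfolding minimal_zero_sum_def by fastforce
qed

section \<open>Sets of lengths of transfer Krull monoids\<close>

lemma sum_mset_image_count:
  fixes f :: "'c \<Rightarrow> 'a::ab_group_add"
  shows "sum_mset (image_mset f S) = (\<Sum>x\<in>set_mset S. sum_mset (replicate_mset (count S x) (f x)))"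
proof -
  have "S = (\<Sum>x\<in>set_mset S. replicate_mset (count S x) x)"
    by (rule multiset_eqI) (auto simp: count_sum not_in_iff)
  moreover have sum: "sum_mset (image_mset f (\<Sum>x\<in>A. F x)) = (\<Sum>x\<in>A. sum_mset (image_mset f (F x)))"
    if "finite A" for A and F :: "'c \<Rightarrow> 'c multiset"
    using that by (induction A) auto
  ultimately have "sum_mset (image_mset f S) =
      (\<Sum>x\<in>set_mset S. sum_mset (image_mset f (replicate_mset (count S x) x)))"
    using sum[OF finite_set_mset[of S], of "\<lambda>x. replicate_mset (count S x) x"] by argo
  then show ?thesis by simp
qed

text \<open>
  The group is written multiplicatively and lives on a carrier. An injective homomorphism into a
  type of class \<open>ab_group_add\<close> turns zero-sum sequences over \<open>G\<close> into multisets with sum \<open>0\<close>.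
\<close>

locale additive_embedding = comm_group G for G :: "('g, 'b) monoid_scheme" (structure) +
  fixes e :: "'g \<Rightarrow> 'a::ab_group_add"
  assumes e_mult: "x \<in> carrier G \<Longrightarrow> y \<in> carrier G \<Longrightarrow> e (x \<otimes> y) = e x + e y"
    and inj_e: "inj_on e (carrier G)"
begin

abbreviation B :: "'g multiset monoid" where "B \<equiv> zero_sum_monoid G"

lemma e_one: "e \<one> = 0"
  using e_mult[of \<one> \<one>] by simp

lemma e_pow: "x \<in> carrier G \<Longrightarrow> e (x [^] (k::nat)) = sum_mset (replicate_mset k (e x))"
  by (induction k) (simp_all add: e_one e_mult add.commute)

lemma e_finprod:
  assumes "finite A" "f \<in> A \<rightarrow> carrier G"
  shows "e (finprod G f A) = (\<Sum>x\<in>A. e (f x))"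
  using assms by (induction A) (simp_all add: e_one e_mult Pi_def)

lemma e_seq_sum:
  assumes "set_mset S \<subseteq> carrier G"
  shows "e (seq_sum G S) = sum_mset (image_mset e S)"
proof -
  have "e (seq_sum G S) = (\<Sum>g\<in>set_mset S. e (g [^] count S g))"
    unfolding seq_sum_def using assms by (intro e_finprod) auto
  also have "\<dots> = (\<Sum>g\<in>set_mset S. sum_mset (replicate_mset (count S g) (e g)))"
    using assms by (intro sum.cong) (auto simp: e_pow)
  finally show ?thesis by (simp add: sum_mset_image_count)
qed

lemma carrier_zero_sum_monoid:
  "S \<in> carrier B \<longleftrightarrow> set_mset S \<subseteq> carrier G \<and> sum_mset (image_mset e S) = 0"
proof -
  have "seq_sum G S = \<one> \<longleftrightarrow> sum_mset (image_mset e S) = 0" if "set_mset S \<subseteq> carrier G"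
  proof -
    have "seq_sum G S \<in> carrier G" unfolding seq_sum_def using that by (intro finprod_closed) auto
    then have "seq_sum G S = \<one> \<longleftrightarrow> e (seq_sum G S) = e \<one>"
      using inj_e by (auto dest: inj_onD)
    then show ?thesis using e_seq_sum[OF that] e_one by simp
  qed
  then show ?thesis by (auto simp: zero_sum_monoid_def)
qed

lemma mult_zero_sum_monoid [simp]: "S \<otimes>\<^bsub>B\<^esub> T = S + T"
  and one_zero_sum_monoid [simp]: "\<one>\<^bsub>B\<^esub> = {#}"
  by (simp_all add: zero_sum_monoid_def)

lemma Units_zero_sum_monoid [simp]: "Units B = {{#}}"
  by (auto simp: Units_def carrier_zero_sum_monoid)

lemma list_prod_zero_sum_monoid [simp]: "list_prod B Ss = sum_list Ss"
  by (induction Ss) (simp_all add: list_prod_def)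

lemma atoms_zero_sum_monoid:
  "S \<in> atoms B \<longleftrightarrow> set_mset S \<subseteq> carrier G \<and> minimal_zero_sum (image_mset e S)"
proof
  assume S: "S \<in> atoms B"
  then have SC: "set_mset S \<subseteq> carrier G" "sum_mset (image_mset e S) = 0" "S \<noteq> {#}"
    by (auto simp: atoms_def carrier_zero_sum_monoid)
  have "W = {#} \<or> W = image_mset e S" if W: "W \<subseteq># image_mset e S" "sum_mset W = 0" for W
  proof -
    obtain W' where "image_mset e S = W + W'" using W(1) by (metis mset_subset_eq_exists_conv)
    then obtain T T' where T: "S = T + T'" "image_mset e T = W" "image_mset e T' = W'"
      by (metis image_mset_eq_plusD)
    then have "T \<in> carrier B" "T' \<in> carrier B"
      using SC W(2) by (auto simp: carrier_zero_sum_monoid)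
    then have "T = {#} \<or> T' = {#}" using S T(1) by (auto simp: atoms_def)
    then show ?thesis using T by auto
  qed
  then show "set_mset S \<subseteq> carrier G \<and> minimal_zero_sum (image_mset e S)"
    using SC by (auto simp: minimal_zero_sum_def)
next
  assume S: "set_mset S \<subseteq> carrier G \<and> minimal_zero_sum (image_mset e S)"
  have "T = {#} \<or> T' = {#}" if "T \<in> carrier B" "S = T + T'" for T T'
  proof -
    have "image_mset e T \<subseteq># image_mset e S" using that(2) by (simp add: image_mset_subseteq_mono)
    then have "image_mset e T = {#} \<or> image_mset e T = image_mset e S"
      using S that(1) by (auto simp: minimal_zero_sum_def carrier_zero_sum_monoid)
    then show ?thesis using that(2) by auto
  qed
  then show "S \<in> atoms B"
    using S by (auto simp: atoms_def carrier_zero_sum_monoid minimal_zero_sum_def)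
qed

lemma length_set_zero_sum_monoid:
  assumes "S \<in> carrier B"
  shows "length_set B S = factorization_lengths (image_mset e S)"
proof -
  have "k \<in> factorization_lengths (image_mset e S) \<longleftrightarrow>
      (\<exists>us. length us = k \<and> set us \<subseteq> atoms B \<and> sum_list us = S)" for k
  proof
    assume "k \<in> factorization_lengths (image_mset e S)"
    then obtain \<V> where V: "size \<V> = k" "\<forall>V \<in># \<V>. minimal_zero_sum V" "\<Sum>\<^sub># \<V> = image_mset e S"
      by (rule factorization_lengthsE)
    obtain Vs where Vs: "mset Vs = \<V>" using ex_mset by blast
    define f where "f = inv_into (carrier G) e"
    have fe: "image_mset e (image_mset f V) = V" "set_mset (image_mset f V) \<subseteq> carrier G"
      if "V \<in> set Vs" for V
    proof -
      have "set_mset V \<subseteq> set_mset (\<Sum>\<^sub># \<V>)" using that Vs by auto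
      then have "set_mset V \<subseteq> e ` carrier G"
        using V(3) assms by (auto simp: carrier_zero_sum_monoid)
      then show "image_mset e (image_mset f V) = V" "set_mset (image_mset f V) \<subseteq> carrier G"
        by (auto simp: f_def image_mset.compositionality f_inv_into_f inv_into_into subset_iff
            intro!: multiset.map_ident_strong)
    qed
    have "sum_list (map (image_mset f) Vs) = image_mset f (sum_list Vs)"
      by (induction Vs) auto
    also have "sum_list Vs = image_mset e S" using V(3) Vs by (metis sum_mset_sum_list)
    also have "image_mset f (image_mset e S) = S"
      using assms inj_e by (auto simp: f_def image_mset.compositionality carrier_zero_sum_monoid subset_iff
            intro!: multiset.map_ident_strong)
    finally have "sum_list (map (image_mset f) Vs) = S" .
    moreover have "set (map (image_mset f) Vs) \<subseteq> atoms B"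
      using fe V(2) Vs by (auto simp: atoms_zero_sum_monoid)
    ultimately show "\<exists>us. length us = k \<and> set us \<subseteq> atoms B \<and> sum_list us = S"
      using V(1) Vs by (intro exI[of _ "map (image_mset f) Vs"]) auto
  next
    assume "\<exists>us. length us = k \<and> set us \<subseteq> atoms B \<and> sum_list us = S"
    then obtain us where us: "length us = k" "set us \<subseteq> atoms B" "sum_list us = S" by blast
    have "image_mset e (sum_list us) = \<Sum>\<^sub># (mset (map (image_mset e) us))"
      by (induction us) auto
    then show "k \<in> factorization_lengths (image_mset e S)"
      using factorization_lengthsI[of "mset (map (image_mset e) us)"] us
      by (auto simp: atoms_zero_sum_monoid subset_iff)
  qed
  moreover have "{#} \<notin> atoms B" by (simp add: atoms_def)
  ultimately show ?thesis unfolding length_set_def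
    using zero_in_factorization_lengths_iff[of "image_mset e S"] factorization_lengths_le_size[of _ "{#} :: 'a multiset"]
    by (auto simp: Suc_le_eq intro: gr0I)
qed

context
  fixes H :: "('h, 'c) monoid_scheme" and \<theta> :: "'h \<Rightarrow> 'g multiset"
  assumes transfer: "weak_transfer_hom H B \<theta>"
begin

interpretation weak_transfer_hom H B \<theta> by (fact transfer)

lemma list_prod_closed: "set us \<subseteq> carrier H \<Longrightarrow> list_prod H us \<in> carrier H"
  by (induction us) (auto simp: list_prod_def)

lemma transfer_list_prod: "set us \<subseteq> carrier H \<Longrightarrow> \<theta> (list_prod H us) = sum_list (map \<theta> us)"
proof (induction us)
  case Nil
  then show ?case using hom_one by (simp add: list_prod_def)
next
  case (Cons u us)
  have "list_prod H us \<in> carrier H" using Cons.prems list_prod_closed by simp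
  then show ?case using Cons hom_mult[OF hom, of u "list_prod H us"] by (simp add: list_prod_def)
qed

lemma transfer_unit_iff: "a \<in> carrier H \<Longrightarrow> a \<in> Units H \<longleftrightarrow> \<theta> a = {#}"
  using T1_units by auto

lemma atoms_subset_carrier: "atoms H \<subseteq> carrier H"
  by (auto simp: atoms_def)

text \<open>
  A factorization of \<open>\<theta> u\<close> into atoms lifts to a factorization of \<open>u\<close> with the same number of
  factors. If there were two or more factors, then all but the first would have a unit as their
  product, although a nonempty product of nonempty sequences is not empty.
\<close>

lemma transfer_atom:
  assumes u: "u \<in> atoms H"
  shows "\<theta> u \<in> atoms B"
proof -
  have uC: "u \<in> carrier H" "u \<notin> Units H" using u by (auto simp: atoms_def)
  have "\<theta> u \<in> carrier B - Units B"
    using uC hom transfer_unit_iff by (auto simp: hom_def)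
  then obtain vs where vs: "vs \<noteq> []" "set vs \<subseteq> atoms B" "list_prod B vs = \<theta> u"
    using B.atomic by blast
  obtain us where us: "length us = length vs" "set us \<subseteq> atoms H" "u = list_prod H us"
    using WT2[OF uC(1) vs(1,2) vs(3)[symmetric]] by blast
  have usC: "set us \<subseteq> carrier H" using us(2) atoms_subset_carrier by blast
  have "length vs = 1"
  proof (rule ccontr)
    assume "length vs \<noteq> 1"
    then obtain u1 u2 us' where split: "us = u1 # u2 # us'"
      using us(1) vs(1) by (cases us; cases "tl us") auto
    have "u = u1 \<otimes>\<^bsub>H\<^esub> list_prod H (u2 # us')" using us(3) split by (simp add: list_prod_def)
    moreover have "u1 \<in> carrier H" "list_prod H (u2 # us') \<in> carrier H"
      using usC split list_prod_closed by auto
    ultimately have "u1 \<in> Units H \<or> list_prod H (u2 # us') \<in> Units H"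
      using u by (auto simp: atoms_def)
    moreover have "u1 \<notin> Units H" "u2 \<notin> Units H" using us(2) split by (auto simp: atoms_def)
    ultimately have "\<theta> (list_prod H (u2 # us')) = {#}"
      using transfer_unit_iff list_prod_closed usC split by auto
    then have "\<theta> u2 = {#}" using transfer_list_prod[of "u2 # us'"] usC split by simp
    then show False using \<open>u2 \<notin> Units H\<close> transfer_unit_iff usC split by auto
  qed
  then show ?thesis using vs by (cases vs) auto
qed

lemma length_set_transfer:
  assumes a: "a \<in> carrier H"
  shows "length_set H a = length_set B (\<theta> a)"
proof (cases "a \<in> Units H")
  case True
  then show ?thesis using transfer_unit_iff[OF a] by (simp add: length_set_def)
next
  case False
  then have "\<theta> a \<notin> Units B" using transfer_unit_iff[OF a] by simp
  moreover have "(\<exists>us. length us = k \<and> set us \<subseteq> atoms H \<and> list_prod H us = a) \<longleftrightarrow>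
      (\<exists>vs. length vs = k \<and> set vs \<subseteq> atoms B \<and> list_prod B vs = \<theta> a)" if "k \<ge> 1" for k
  proof
    assume "\<exists>us. length us = k \<and> set us \<subseteq> atoms H \<and> list_prod H us = a"
    then obtain us where us: "length us = k" "set us \<subseteq> atoms H" "list_prod H us = a" by blast
    then show "\<exists>vs. length vs = k \<and> set vs \<subseteq> atoms B \<and> list_prod B vs = \<theta> a"
      using transfer_list_prod[of us] transfer_atom atoms_subset_carrier
      by (intro exI[of _ "map \<theta> us"]) auto
  next
    assume "\<exists>vs. length vs = k \<and> set vs \<subseteq> atoms B \<and> list_prod B vs = \<theta> a"
    then obtain vs where vs: "length vs = k" "set vs \<subseteq> atoms B" "list_prod B vs = \<theta> a" by blast
    then have "vs \<noteq> []" using that by auto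
    from WT2[OF a this vs(2) vs(3)[symmetric]] vs(1)
    show "\<exists>us. length us = k \<and> set us \<subseteq> atoms H \<and> list_prod H us = a" by metis
  qed
  ultimately show ?thesis using False unfolding length_set_def by auto
qed

lemma transfer_surj: "\<theta> ` carrier H = carrier B"
  using T1_surj by (auto simp: set_mult_def)

lemma length_system_transfer:
  "length_system H = factorization_lengths ` {A. set_mset A \<subseteq> e ` carrier G \<and> sum_mset A = 0}"
proof -
  have "length_system H = length_set B ` \<theta> ` carrier H"
    unfolding length_system_def image_image by (rule image_cong) (simp_all add: length_set_transfer)
  also have "\<dots> = factorization_lengths ` image_mset e ` carrier B"
    unfolding transfer_surj image_image by (rule image_cong) (simp_all add: length_set_zero_sum_monoid)
  also have "image_mset e ` carrier B = {A. set_mset A \<subseteq> e ` carrier G \<and> sum_mset A = 0}"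
  proof (intro equalityI subsetI)
    fix A assume A: "A \<in> {A. set_mset A \<subseteq> e ` carrier G \<and> sum_mset A = 0}"
    define f where "f = inv_into (carrier G) e"
    have "image_mset e (image_mset f A) = A" "set_mset (image_mset f A) \<subseteq> carrier G"
      using A by (auto simp: f_def image_mset.compositionality f_inv_into_f inv_into_into subset_iff
            intro!: multiset.map_ident_strong)
    then show "A \<in> image_mset e ` carrier B"
      using A by (intro image_eqI[of _ _ "image_mset f A"]) (auto simp: carrier_zero_sum_monoid)
  qed (auto simp: carrier_zero_sum_monoid subset_iff)
  finally show ?thesis .
qed

end
end

section \<open>Blocks with sum in the kernel\<close>

text \<open>
  In the application, \<open>C\<close> is a copy of the group \<open>C\<^sub>2 \<oplus> C\<^sub>2 \<oplus> C\<^sub>2\<^sub>n\<close> and \<open>\<chi>\<close> is its quotient map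
  modulo \<open>2C\<close>, onto an elementary abelian group of order \<open>8\<close>. The values of \<open>\<chi>\<close> are called
  classes.
\<close>

locale class_map =
  fixes C :: "'a::ab_group_add set"
    and \<chi> :: "'a \<Rightarrow> 'b::{ab_group_add, finite}"
    and n :: nat
  assumes n_ge_2: "n \<ge> 2"
    and zero_C: "0 \<in> C"
    and add_C: "x \<in> C \<Longrightarrow> y \<in> C \<Longrightarrow> x + y \<in> C"
    and neg_C: "x \<in> C \<Longrightarrow> - x \<in> C"
    and class_add: "\<chi> (x + y) = \<chi> x + \<chi> y"
    and card_kernel: "card {x \<in> C. \<chi> x = 0} = n"
    and class_double: "v + v = (0 :: 'b)"
    and card_classes: "card (UNIV :: 'b set) = 8"
begin

definition kernel :: "'a set" where "kernel = {x \<in> C. \<chi> x = 0}"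

lemma card_kernel_eq: "card kernel = n"
  using card_kernel by (simp add: kernel_def)

lemma finite_kernel: "finite kernel"
  using card_kernel_eq n_ge_2 card.infinite by fastforce

lemma class_zero [simp]: "\<chi> 0 = 0"
  using class_add[of 0 0] by simp

lemma class_sum_mset: "\<chi> (sum_mset S) = sum_mset (image_mset \<chi> S)"
  by (induction S) (auto simp: class_add)

lemma sum_mset_C: "set_mset S \<subseteq> C \<Longrightarrow> sum_mset S \<in> C"
  by (induction S) (auto simp: zero_C add_C)

lemma sum_in_kernelI: "set_mset S \<subseteq> C \<Longrightarrow> sum_mset (image_mset \<chi> S) = 0 \<Longrightarrow> sum_mset S \<in> kernel"
  by (auto simp: kernel_def sum_mset_C class_sum_mset)

lemma kernel_add: "x \<in> kernel \<Longrightarrow> y \<in> kernel \<Longrightarrow> x + y \<in> kernel"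
  by (auto simp: kernel_def add_C class_add)

lemma kernel_sum_blocks:
  assumes "\<forall>B \<in> set Bs. sum_mset B \<in> kernel"
  shows "sum_mset (sum_list Bs) \<in> kernel"
  using assms
proof (induction Bs)
  case (Cons B Bs)
  then show ?case using kernel_add[of "sum_mset B" "sum_mset (sum_list Bs)"] by simp
qed (simp add: kernel_def zero_C)

text \<open>
  Two equal partial sums would differ by the sum of the blocks in between, which form a proper
  nonempty part of \<open>U\<close>.
\<close>

lemma partial_block_sums:
  assumes U: "minimal_zero_sum U" and dec: "sum_list Bs + W = U" "W \<noteq> {#}"
    and Bs: "\<forall>B \<in> set Bs. B \<noteq> {#} \<and> sum_mset B \<in> kernel"
  shows "inj_on (\<lambda>i. sum_mset (sum_list (take i Bs))) {..length Bs}"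
    and "(\<lambda>i. sum_mset (sum_list (take i Bs))) ` {..length Bs} \<subseteq> kernel"
proof -
  show "inj_on (\<lambda>i. sum_mset (sum_list (take i Bs))) {..length Bs}"
  proof (rule linorder_inj_onI')
    fix i j assume ij: "i \<in> {..length Bs}" "j \<in> {..length Bs}" "i < j"
    define M where "M = sum_list (drop i (take j Bs))"
    have "take j Bs = take i Bs @ drop i (take j Bs)"
      using ij by (metis append_take_drop_id min.absorb1 less_imp_le take_take)
    then have j: "sum_list (take j Bs) = sum_list (take i Bs) + M"
      unfolding M_def by (metis sum_list_append)
    have "Bs ! i \<in> set (drop i (take j Bs))"
      using ij by (auto simp: in_set_conv_nth intro!: exI[of _ 0])
    moreover have "Bs ! i \<noteq> {#}" using Bs ij by auto
    ultimately have "M \<noteq> {#}" unfolding M_def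
      by (auto dest!: split_list simp: sum_list_append)
    have "Bs = take i Bs @ drop i (take j Bs) @ drop j Bs"
      using \<open>take j Bs = _\<close> by (metis append_assoc append_take_drop_id)
    then have "sum_list Bs = sum_list (take i Bs) + M + sum_list (drop j Bs)"
      unfolding M_def by (metis sum_list_append add.assoc)
    then have "U = M + (sum_list (take i Bs) + sum_list (drop j Bs) + W)"
      unfolding dec(1)[symmetric] by (simp only: add_ac)
    then have "M \<subset># U" using dec(2) by (auto simp: subset_mset_def)
    then have "sum_mset M \<noteq> 0" using U \<open>M \<noteq> {#}\<close> minimal_zero_sum_sub by blast
    then show "sum_mset (sum_list (take i Bs)) \<noteq> sum_mset (sum_list (take j Bs))"
      unfolding j by simp
  qed
  show "(\<lambda>i. sum_mset (sum_list (take i Bs))) ` {..length Bs} \<subseteq> kernel"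
    using Bs by (auto intro!: kernel_sum_blocks dest: in_set_takeD)
qed

lemma number_of_blocks_le:
  assumes U: "minimal_zero_sum U" and dec: "sum_list Bs = U"
    and Bs: "\<forall>B \<in> set Bs. B \<noteq> {#} \<and> sum_mset B \<in> kernel"
  shows "length Bs \<le> n"
proof (cases Bs rule: rev_cases)
  case (snoc Bs' W)
  note p = partial_block_sums[OF U, of Bs' W]
  have "card ((\<lambda>i. sum_mset (sum_list (take i Bs'))) ` {..length Bs'}) \<le> n"
    using card_mono[OF finite_kernel] p(2) snoc dec Bs by (simp add: card_kernel_eq)
  then show ?thesis using p(1) snoc dec Bs by (simp add: card_image)
qed auto

text \<open>
  Let \<open>w\<close> be the sum of \<open>W = S + T\<close>. The \<open>n - 1\<close> elements \<open>w + s\<close>, where \<open>s\<close> is a partial sum of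
  \<open>Bs\<close>, are distinct and lie in the kernel, so only one element \<open>c\<close> of the kernel remains. The sum
  of \<open>S\<close> is not of the form \<open>w + s\<close>, because otherwise \<open>T\<close> together with the first few blocks
  would have sum zero. So it is \<open>c\<close>, whatever the splitting of \<open>W\<close> is.
\<close>

lemma common_block_sum:
  assumes U: "minimal_zero_sum U" and dec: "sum_list Bs + W = U" and len: "length Bs = n - 2"
    and Bs: "\<forall>B \<in> set Bs. B \<noteq> {#} \<and> sum_mset B \<in> kernel"
  shows "\<exists>c. \<forall>S T. S + T = W \<longrightarrow> S \<noteq> {#} \<longrightarrow> T \<noteq> {#} \<longrightarrow>
     sum_mset S \<in> kernel \<longrightarrow> sum_mset T \<in> kernel \<longrightarrow> sum_mset S = c \<and> c \<noteq> 0"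
proof (cases "sum_mset W \<in> kernel \<and> W \<noteq> {#}")
  case False
  have "sum_mset W \<in> kernel \<and> W \<noteq> {#}"
    if "S + T = W" "S \<noteq> {#}" "sum_mset S \<in> kernel" "sum_mset T \<in> kernel" for S T
    using that kernel_add[of "sum_mset S" "sum_mset T"] by auto
  then show ?thesis using False by metis
next
  case True
  define s where "s = (\<lambda>i. sum_mset (sum_list (take i Bs)))"
  have inj: "inj_on s {..length Bs}" and ker: "s ` {..length Bs} \<subseteq> kernel"
    using partial_block_sums[OF U dec _ Bs] True by (auto simp: s_def)
  define A where "A = (\<lambda>i. sum_mset W + s i) ` {..length Bs}"
  have "card A = n - 1"
    unfolding A_def using inj n_ge_2 len by (subst card_image) (auto simp: inj_on_def)
  moreover have "A \<subseteq> kernel" using ker True by (auto simp: A_def intro!: kernel_add)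
  ultimately have "card (kernel - A) = 1"
    using n_ge_2 finite_kernel by (subst card_Diff_subset) (auto simp: card_kernel_eq finite_subset)
  then obtain c where c: "kernel - A = {c}" by (auto simp: card_1_singleton_iff)
  have "sum_mset S = c \<and> c \<noteq> 0" if ST: "S + T = W" "S \<noteq> {#}" "T \<noteq> {#}" "sum_mset S \<in> kernel" "sum_mset T \<in> kernel" for S T
  proof -
    have "sum_mset S \<notin> A"
    proof
      assume "sum_mset S \<in> A"
      then obtain i where "i \<le> length Bs" "sum_mset S = sum_mset W + s i" by (auto simp: A_def)
      then have z: "sum_mset (T + sum_list (take i Bs)) = 0"
        unfolding ST(1)[symmetric] s_def by (simp add: algebra_simps)
      have "sum_list Bs = sum_list (take i Bs) + sum_list (drop i Bs)"
        by (metis append_take_drop_id sum_list_append)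
      then have "U = (T + sum_list (take i Bs)) + (S + sum_list (drop i Bs))"
        unfolding dec[symmetric] ST(1)[symmetric] by (simp only: add_ac)
      then have "T + sum_list (take i Bs) \<subset># U" using ST(2)
        by (auto simp: subset_mset_def)
      then show False using z U ST(3) minimal_zero_sum_sub by blast
    qed
    moreover have "sum_mset S \<noteq> 0"
    proof -
      have "U = S + (T + sum_list Bs)" unfolding dec[symmetric] ST(1)[symmetric] by (simp only: add_ac)
      then have "S \<subset># U" using ST(3) by (auto simp: subset_mset_def)
      then show ?thesis using U ST(2) minimal_zero_sum_sub by blast
    qed
    ultimately show ?thesis using c ST(4) by auto
  qed
  then show ?thesis by blast
qed

subsection \<open>The eight classes\<close>

lemma class_add_eq_0_iff: "v + w = 0 \<longleftrightarrow> v = (w :: 'b)"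
  using class_double by (metis add_right_cancel)

lemma class_double_left: "v + (v + w) = (w :: 'b)"
  by (simp add: class_double flip: add.assoc)

lemma class_basis:
  obtains a b c :: 'b where
    "distinct [0, a, b, a + b, c, a + c, b + c, a + b + c]"
    "UNIV = set [0, a, b, a + b, c, a + c, b + c, a + b + c]"
proof -
  have ex: "\<exists>v. v \<notin> A" if "card A < 8" for A :: "'b set"
    using that card_classes by (metis UNIV_eq_I less_irrefl)
  obtain a :: 'b where a: "a \<notin> {0}" using ex[of "{0}"] by auto
  have "card {0, a} \<le> 2" by (simp add: card_insert_if)
  then obtain b where b: "b \<notin> {0, a}" using ex[of "{0, a}"] by auto
  have "card {0, a, b, a + b} \<le> 4" by (simp add: card_insert_if)
  then obtain c where c: "c \<notin> {0, a, b, a + b}" using ex[of "{0, a, b, a + b}"] by auto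
  define V where "V = [0, a, b, a + b]"
  have closed: "x + y \<in> set V" if "x \<in> set V" "y \<in> set V" for x y
  proof -
    have "b + a = a + b" "a + (a + b) = b" "b + (a + b) = a" "(a + b) + a = b" "(a + b) + b = a"
      "(a + b) + (a + b) = 0"
      by (metis add.commute class_double_left class_double)+
    then show ?thesis using that by (auto simp: V_def class_double)
  qed
  have "distinct V" unfolding V_def using a b class_add_eq_0_iff[of a b] by auto
  moreover have "c \<notin> set V" using c by (auto simp: V_def)
  then have "x \<noteq> y + c" if "x \<in> set V" "y \<in> set V" for x y
    using closed[OF that] class_double_left[of y c] by (metis add.commute)
  ultimately have "distinct (V @ map (\<lambda>x. x + c) V)"
    by (auto simp: distinct_map inj_on_def)
  then have d: "distinct [0, a, b, a + b, c, a + c, b + c, a + b + c]" by (simp add: V_def)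
  have "card (set [0, a, b, a + b, c, a + c, b + c, a + b + c]) = card (UNIV :: 'b set)"
    using distinct_card[OF d] card_classes by simp
  then have "UNIV = set [0, a, b, a + b, c, a + c, b + c, a + b + c]"
    by (metis card_subset_eq finite_class.finite_UNIV subset_UNIV)
  with d that show ?thesis by blast
qed

lemma sum_all_classes: "\<Sum>(UNIV :: 'b set) = 0"
proof -
  obtain a b c :: 'b where d: "distinct [0, a, b, a + b, c, a + c, b + c, a + b + c]"
    and U: "UNIV = set [0, a, b, a + b, c, a + c, b + c, a + b + c]" by (rule class_basis)
  have "\<Sum>(UNIV :: 'b set) = sum_list [0, a, b, a + b, c, a + c, b + c, a + b + c]"
    unfolding U sum.distinct_set_conv_list[OF d] by simp
  also have "\<dots> = (a + a) + (a + a) + (b + b) + (b + b) + (c + c) + (c + c)"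
    by (simp add: add_ac)
  finally show ?thesis by (simp only: class_double add_0)
qed

text \<open>
  A set of one or two nonzero classes never has sum zero. The sum of all classes is zero, so the
  set of nonzero classes outside \<open>D\<close> also has sum zero, which excludes the sizes \<open>5\<close> and \<open>6\<close> as
  well.
\<close>

lemma card_zero_sum_classes:
  assumes "0 \<notin> D" "\<Sum>D = (0 :: 'b)"
  shows "card D \<in> {0, 3, 4, 7}"
proof -
  have small: "card E \<notin> {1, 2}" if "0 \<notin> E" "\<Sum>E = 0" for E :: "'b set"
    using that by (auto simp: card_1_singleton_iff card_2_iff class_add_eq_0_iff)
  define E where "E = UNIV - {0} - D"
  have *: "(UNIV :: 'b set) = insert 0 (D \<union> E)" "0 \<notin> D \<union> E" "D \<inter> E = {}"
    using assms(1) by (auto simp: E_def)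
  have "\<Sum>(UNIV :: 'b set) = \<Sum>D + \<Sum>E" "card (UNIV :: 'b set) = 1 + (card D + card E)"
    unfolding *(1) using *(2,3) by (simp_all add: sum.union_disjoint card_Un_disjoint)
  then have "\<Sum>E = 0" "card D + card E = 7" using sum_all_classes assms card_classes by auto
  moreover have "card E \<noteq> 1 \<and> card E \<noteq> 2 \<and> card D \<noteq> 1 \<and> card D \<noteq> 2"
    using small[of E] small[of D] assms \<open>\<Sum>E = 0\<close> by (auto simp: E_def)
  ultimately have "card D = 0 \<or> card D = 3 \<or> card D = 4 \<or> card D = 7" by arith
  then show ?thesis by blast
qed

text \<open>
  The classes \<open>0\<close>, the four elements of \<open>D\<close>, and the sums of one fixed element of \<open>D\<close> with the
  three others are distinct, so they are all eight classes.
\<close>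

lemma class_of_plane:
  assumes D: "card D = 4" "0 \<notin> D" "\<Sum>D = (0 :: 'b)"
  shows "f = 0 \<or> f \<in> D \<or> (\<exists>v\<in>D. \<exists>w\<in>D. v \<noteq> w \<and> f = v + w)"
proof -
  obtain v x y z where vxyz: "D = {v, x, y, z}" and 2: "v \<noteq> x" "v \<noteq> y" "v \<noteq> z" "x \<noteq> y" "x \<noteq> z" "y \<noteq> z"
    using D(1) by (auto simp: numeral_eq_Suc card_Suc_eq)
  have s: "v + (x + (y + z)) = 0" using D(3) vxyz 2 by simp
  have nz: "v \<noteq> 0" "x \<noteq> 0" "y \<noteq> 0" "z \<noteq> 0" using D(2) vxyz by auto
  have "(v + x) + (y + z) = 0" "(v + y) + (x + z) = 0" "(v + z) + (x + y) = 0"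
    using s by (simp_all only: add_ac)
  then have t: "v + x = y + z" "v + y = x + z" "v + z = x + y"
    by (simp_all only: class_add_eq_0_iff)
  have z: "v + x \<noteq> 0" "v + y \<noteq> 0" "v + z \<noteq> 0" using 2 by (simp_all add: class_add_eq_0_iff)
  have u: "v + x \<noteq> y" "v + x \<noteq> z" "v + y \<noteq> x" "v + y \<noteq> z" "v + z \<noteq> x" "v + z \<noteq> y"
    unfolding t using nz by simp_all
  have d: "distinct [0, v, x, y, z, v + x, v + y, v + z]"
    using nz 2 z u z[symmetric] u[symmetric] nz[symmetric] by simp
  have "card (set [0, v, x, y, z, v + x, v + y, v + z]) = card (UNIV :: 'b set)"
    using distinct_card[OF d] card_classes by simp
  then have "UNIV = set [0, v, x, y, z, v + x, v + y, v + z]"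
    by (metis card_subset_eq finite_class.finite_UNIV subset_UNIV)
  then have "f \<in> set [0, v, x, y, z, v + x, v + y, v + z]" by blast
  then show ?thesis using vxyz 2 by auto
qed

end

section \<open>The structure of long minimal zero-sum sequences\<close>

context class_map
begin

definition equal_class_pair :: "'a multiset \<Rightarrow> bool" where
  "equal_class_pair P \<longleftrightarrow> (\<exists>p q. P = {#p, q#} \<and> \<chi> p = \<chi> q)"

text \<open>
  Pairs of equal class are removed as long as possible. The elements that are left over have
  distinct classes, so they are given by the set \<open>D\<close> of their classes and a choice \<open>r\<close> of
  representatives.
\<close>

lemma split_into_pairs:
  "\<exists>Ps D r. sum_list Ps + image_mset r (mset_set D) = U \<and> (\<forall>P \<in> set Ps. equal_class_pair P) \<and>
     (\<forall>v \<in> D. \<chi> (r v) = v)"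
proof (induction U rule: measure_induct_rule[of size])
  case (less U)
  show ?case
  proof (cases "\<exists>p q. {#p, q#} \<subseteq># U \<and> \<chi> p = \<chi> q")
    case True
    then obtain p q U' where U: "U = {#p, q#} + U'" and pq: "\<chi> p = \<chi> q"
      by (metis mset_subset_eq_exists_conv)
    obtain Ps D r where "sum_list Ps + image_mset r (mset_set D) = U'"
      "\<forall>P \<in> set Ps. equal_class_pair P" "\<forall>v \<in> D. \<chi> (r v) = v"
      using less.IH[of U'] U by auto
    then show ?thesis using U pq
      by (intro exI[of _ "{#p, q#} # Ps"] exI[of _ D] exI[of _ r])
        (auto simp: equal_class_pair_def)
  next
    case False
    define D where "D = \<chi> ` set_mset U"
    define r where "r = inv_into (set_mset U) \<chi>"
    have inj: "inj_on \<chi> (set_mset U)"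
    proof (rule inj_onI, rule ccontr)
      fix p q assume "p \<in># U" "q \<in># U" "\<chi> p = \<chi> q" "p \<noteq> q"
      then have "{#p, q#} \<subseteq># U" by (simp add: insert_subset_eq_iff in_diff_count)
      with False \<open>\<chi> p = \<chi> q\<close> show False by blast
    qed
    have "count U p \<le> 1" for p
    proof (rule ccontr)
      assume "\<not> count U p \<le> 1"
      then have "{#p, p#} \<subseteq># U" by (simp add: subseteq_mset_def)
      with False show False by blast
    qed
    then have "mset_set (set_mset U) = U"
      by (intro multiset_eqI) (metis count_eq_zero_iff count_greater_zero_iff count_mset_set(1,3) finite_set_mset le_antisym less_eq_Suc_le One_nat_def)
    moreover have "image_mset r (mset_set D) = image_mset r (image_mset \<chi> (mset_set (set_mset U)))"
      unfolding D_def by (simp add: image_mset_mset_set inj)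
    moreover have "image_mset r (image_mset \<chi> U) = image_mset (\<lambda>x. x) U"
      unfolding r_def image_mset.compositionality
      by (intro image_mset_cong) (simp add: inj)
    ultimately have "image_mset r (mset_set D) = U" by simp
    moreover have "\<forall>v \<in> D. \<chi> (r v) = v" by (auto simp: D_def r_def inj)
    ultimately show ?thesis
      by (intro exI[of _ "[]"] exI[of _ D] exI[of _ r]) auto
  qed
qed

lemma equal_class_pair_block:
  assumes "equal_class_pair P" "set_mset P \<subseteq> C"
  shows "P \<noteq> {#}" "sum_mset P \<in> kernel" "size P = 2"
  using assms by (auto simp: equal_class_pair_def kernel_def add_C class_add class_double)

lemma sum_list_pairs_size:
  assumes "\<forall>P \<in> set Ps. size (P :: 'c multiset) = 2"
  shows "size (sum_list Ps) = 2 * length Ps"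
  using assms by (induction Ps) auto

lemma set_mset_sum_list: "B \<in> set Bs \<Longrightarrow> set_mset B \<subseteq> set_mset (sum_list Bs)"
  by (auto dest!: split_list)

lemma representatives_block:
  assumes "\<forall>v \<in> D. \<chi> (r v) = v \<and> r v \<in> C" "E \<subseteq> D" "\<Sum>E = 0"
  shows "sum_mset (image_mset r (mset_set E)) \<in> kernel"
proof (rule sum_in_kernelI)
  show "set_mset (image_mset r (mset_set E)) \<subseteq> C" using assms by auto
  have "image_mset \<chi> (image_mset r (mset_set E)) = image_mset (\<lambda>v. v) (mset_set E)"
    unfolding image_mset.compositionality using assms(1,2)
    by (intro image_mset_cong) auto
  then show "sum_mset (image_mset \<chi> (image_mset r (mset_set E))) = 0"
    using assms(3) by (simp add: sum_unfold_sum_mset)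
qed

text \<open>
  Let \<open>m\<close> be the number of pairs, \<open>z \<le> 1\<close> the number of remaining elements of class \<open>0\<close>, and \<open>D0\<close>
  the set of the other remaining classes, so that \<open>size U = 2 * m + z + card D0\<close>. An element of
  class \<open>0\<close> is a block of its own. Bounding the number of blocks by \<open>n\<close> excludes \<open>card D0 = 0\<close> and
  \<open>card D0 = 3\<close>, and for \<open>card D0 = 4\<close> it forces \<open>z = 0\<close> and \<open>m = n - 1\<close>. For \<open>card D0 = 7\<close> all
  seven nonzero classes remain; they are the points of the Fano plane, in which every line and
  every complement of a line is a block, and \<open>common_block_sum\<close> leads to a contradiction.
\<close>

lemma long_minimal_zero_sum_split:
  assumes U: "minimal_zero_sum U" "set_mset U \<subseteq> C" and long: "size U \<ge> 2 * n + 2"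
  obtains Ps D r where "sum_list Ps + image_mset r (mset_set D) = U"
    "\<forall>P \<in> set Ps. equal_class_pair P" "length Ps = n - 1"
    "card D = 4" "0 \<notin> D" "\<Sum>D = 0" "\<forall>v \<in> D. \<chi> (r v) = v"
proof -
  obtain Ps D r where dec: "sum_list Ps + image_mset r (mset_set D) = U"
    and Ps: "\<forall>P \<in> set Ps. equal_class_pair P" and r: "\<forall>v \<in> D. \<chi> (r v) = v"
    using split_into_pairs[of U] by blast
  have PsC: "set_mset P \<subseteq> C" if "P \<in> set Ps" for P
    using set_mset_sum_list[OF that] U(2) unfolding dec[symmetric] by auto
  have PsB: "\<forall>B \<in> set Ps. B \<noteq> {#} \<and> sum_mset B \<in> kernel"
    using equal_class_pair_block PsC Ps by blast
  have rC: "\<forall>v \<in> D. \<chi> (r v) = v \<and> r v \<in> C"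
    using r dec U(2) by auto
  define D0 where "D0 = D - {0}"
  define Z where "Z = (if 0 \<in> D then [{#r 0#}] else [])"
  have D: "image_mset r (mset_set D) = sum_list Z + image_mset r (mset_set D0)"
    by (auto simp: Z_def D0_def mset_set.remove)
  have ZB: "\<forall>B \<in> set Z. B \<noteq> {#} \<and> sum_mset B \<in> kernel"
    using rC by (auto simp: Z_def kernel_def)
  have "sum_mset (sum_list Ps) \<in> kernel" using PsB by (intro kernel_sum_blocks) auto
  then have "\<chi> (sum_mset (image_mset r (mset_set D))) = \<chi> (sum_mset U)"
    unfolding dec[symmetric] by (simp add: class_add kernel_def)
  also have "\<dots> = 0" using U(1) by (simp add: minimal_zero_sum_def)
  also have "\<chi> (sum_mset (image_mset r (mset_set D))) = \<Sum>D"
    unfolding sum_unfold_sum_mset[symmetric] using r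
    by (simp add: class_sum_mset image_mset.compositionality sum_unfold_sum_mset) 
      (metis (mono_tags, lifting) comp_apply finite_class.finite image_mset_cong elem_mset_set image_mset_id id_apply)
  finally have "\<Sum>D0 = 0" by (simp add: D0_def sum_diff1)
  have size_U: "size U = 2 * length Ps + length Z + card D0"
    using sum_list_pairs_size[of Ps] equal_class_pair_block(3) Ps PsC
    by (auto simp: dec[symmetric] D Z_def)
  have D0: "0 \<notin> D0" "D0 \<subseteq> D" by (auto simp: D0_def)
  have blocks: "length Ps + length Z + length Es \<le> n"
    if "sum_list Es = image_mset r (mset_set D0)" "\<forall>B \<in> set Es. B \<noteq> {#} \<and> sum_mset B \<in> kernel" for Es
  proof -
    have "sum_list (Ps @ Z @ Es) = U" using that dec D by simp
    then show ?thesis using number_of_blocks_le[OF U(1), of "Ps @ Z @ Es"] PsB ZB that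
      by (auto simp: add.assoc)
  qed
  have D0B: "sum_mset (image_mset r (mset_set D0)) \<in> kernel"
    using representatives_block[OF rC D0(2) \<open>\<Sum>D0 = 0\<close>] .
  have Z1: "length Z \<le> 1" by (simp add: Z_def)
  consider "card D0 = 0" | "card D0 = 3" | "card D0 = 4" | "card D0 = 7"
    using card_zero_sum_classes[OF D0(1) \<open>\<Sum>D0 = 0\<close>] by auto
  then show ?thesis
  proof cases
    case 1
    then show ?thesis using blocks[of "[]"] size_U long Z1 by auto
  next
    case 2
    then have "D0 \<noteq> {}" by auto
    then show ?thesis using blocks[of "[image_mset r (mset_set D0)]"] D0B size_U long Z1 2
      by (auto simp: mset_set_empty_iff)
  next
    case 3
    then have "D0 \<noteq> {}" by auto
    then have "length Ps + length Z + 1 \<le> n"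
      using blocks[of "[image_mset r (mset_set D0)]"] D0B by (auto simp: mset_set_empty_iff)
    then have "length Ps = n - 1 \<and> length Z = 0" using size_U long 3 by linarith
    then have "length Ps = n - 1" "Z = []" by auto
    then have "D0 = D" by (auto simp: Z_def D0_def split: if_splits)
    with \<open>length Ps = n - 1\<close> 3 D0 \<open>\<Sum>D0 = 0\<close> that[OF dec Ps] r show ?thesis by auto
  next
    case 4
    have D0_all: "D0 = UNIV - {0}"
      using 4 card_classes D0(1) by (intro card_subset_eq) (auto simp: card_Diff_singleton)
    obtain a b c :: 'b where d: "distinct [0, a, b, a + b, c, a + c, b + c, a + b + c]"
      and univ: "UNIV = set [0, a, b, a + b, c, a + c, b + c, a + b + c]" by (rule class_basis)
    have D0_set: "D0 = {a, b, a + b, c, a + c, b + c, a + b + c}"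
      unfolding D0_all univ using d by auto
    have line: "\<Sum>{a, b, a + b} = 0" using d by (simp add: add_ac class_double class_double_left)
    have split: "image_mset r (mset_set L) + image_mset r (mset_set (D0 - L)) = image_mset r (mset_set D0)"
      if "L \<subseteq> D0" for L
      using mset_set_Union[of L "D0 - L"] that by (simp add: Un_absorb1 flip: image_mset_union)
    have compl: "\<Sum>(D0 - L) = 0" if "L \<subseteq> D0" "\<Sum>L = 0" for L
      using that \<open>\<Sum>D0 = 0\<close> by (simp add: sum_diff)
    have Lblock: "sum_mset (image_mset r (mset_set L)) \<in> kernel" if "L \<subseteq> D0" "\<Sum>L = 0" for L
      using representatives_block[OF rC _ that(2)] that(1) D0(2) by blast
    have "length Ps + length Z + 2 \<le> n"
    proof -
      have "{a, b, a + b} \<subseteq> D0" "{a, b, a + b} \<noteq> {}" "D0 - {a, b, a + b} \<noteq> {}"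
        using D0_set d by auto
      then show ?thesis
        using blocks[of "[image_mset r (mset_set {a, b, a + b}), image_mset r (mset_set (D0 - {a, b, a + b}))]"]
          split[of "{a, b, a + b}"] line compl Lblock
        by (auto simp: mset_set_empty_iff)
    qed
    then have len: "length (Ps @ Z) = n - 2" using size_U long 4 Z1 by auto
    have dec': "sum_list (Ps @ Z) + image_mset r (mset_set D0) = U" using dec D by (simp add: add_ac)
    have "\<forall>B \<in> set (Ps @ Z). B \<noteq> {#} \<and> sum_mset B \<in> kernel" using PsB ZB by auto
    then obtain s where "\<forall>S T. S + T = image_mset r (mset_set D0) \<longrightarrow> S \<noteq> {#} \<longrightarrow> T \<noteq> {#} \<longrightarrow>
        sum_mset S \<in> kernel \<longrightarrow> sum_mset T \<in> kernel \<longrightarrow> sum_mset S = s \<and> s \<noteq> 0"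
      using common_block_sum[OF U(1) dec' len] by blast
    then have s: "sum_mset S = s \<and> s \<noteq> 0"
      if "S + T = image_mset r (mset_set D0)" "S \<noteq> {#}" "T \<noteq> {#}" "sum_mset S \<in> kernel" "sum_mset T \<in> kernel" for S T
      using that by blast
    have sL: "sum r L = s \<and> s \<noteq> 0" if "L \<subseteq> D0" "\<Sum>L = 0" "L \<noteq> {}" "L \<noteq> D0" for L
    proof -
      have "image_mset r (mset_set L) \<noteq> {#}" "image_mset r (mset_set (D0 - L)) \<noteq> {#}"
        using that by (auto simp: mset_set_empty_iff)
      then show ?thesis using s[OF split[OF that(1)]] Lblock that compl
        by (auto simp: sum_unfold_sum_mset)
    qed
    have lines: "r x + (r y + r z) = s"
      if "{x, y, z} \<subseteq> D0" "x + (y + z) = 0" "x \<noteq> y" "x \<noteq> z" "y \<noteq> z" for x y z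
    proof -
      have "{x, y, z} \<noteq> D0"
      proof
        assume "{x, y, z} = D0"
        then have "card D0 = card {x, y, z}" by simp
        also have "\<dots> \<le> 3" by (simp add: card_insert_if)
        finally show False using 4 by simp
      qed
      then show ?thesis using sL[of "{x, y, z}"] that by auto
    qed
    have sub: "a \<in> D0" "b \<in> D0" "c \<in> D0" "a + b \<in> D0" "a + c \<in> D0" "b + c \<in> D0" "a + b + c \<in> D0"
      using D0_set by auto
    have zero: "a + (b + (a + b)) = 0" "a + (c + (a + c)) = 0" "a + (b + c + (a + b + c)) = 0"
      "b + (c + (b + c)) = 0" "b + (a + c + (a + b + c)) = 0" "c + (a + b + (a + b + c)) = 0"
      "a + b + (a + c + (b + c)) = 0"
      by (simp_all add: add_ac class_double class_double_left)
    have l: "r a + (r b + r (a + b)) = s" "r a + (r c + r (a + c)) = s"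
      "r a + (r (b + c) + r (a + b + c)) = s" "r b + (r c + r (b + c)) = s"
      "r b + (r (a + c) + r (a + b + c)) = s" "r c + (r (a + b) + r (a + b + c)) = s"
      "r (a + b) + (r (a + c) + r (b + c)) = s"
      using d sub by (intro lines zero; auto)+
    define t where "t = r a + r b + r (a + b) + r c + r (a + c) + r (b + c) + r (a + b + c)"
    have "s \<noteq> 0" "t = s + s"
    proof -
      let ?L = "{a, b, a + b}"
      have "c \<notin> ?L" using d by auto
      then have L: "?L \<subseteq> D0" "?L \<noteq> {}" "D0 - ?L \<noteq> {}" "D0 - ?L \<noteq> D0" "?L \<noteq> D0"
        using sub by blast+
      have "sum r ?L = s \<and> s \<noteq> 0" "sum r (D0 - ?L) = s"
        using sL[OF L(1) line L(2,5)] sL[OF _ compl[OF L(1) line] L(3,4)] by auto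
      moreover have "sum r D0 = sum r ?L + sum r (D0 - ?L)"
        using sum.subset_diff[OF L(1), of r] by (simp add: add.commute)
      moreover have "sum r D0 = t"
      proof -
        have "distinct [a, b, a + b, c, a + c, b + c, a + b + c]" using d by simp
        then have "sum r (set [a, b, a + b, c, a + c, b + c, a + b + c]) =
            sum_list (map r [a, b, a + b, c, a + c, b + c, a + b + c])"
          by (rule sum.distinct_set_conv_list)
        then show ?thesis by (simp add: D0_set t_def add.assoc)
      qed
      ultimately show "s \<noteq> 0" "t = s + s" by auto
    qed
    \<comment> \<open>Every point lies on three of the seven lines, so summing over all lines gives \<open>7 s = 3 t\<close>.\<close>
    have "s + s + s + s + s + s + s =
        (r a + (r b + r (a + b))) + (r a + (r c + r (a + c))) + (r a + (r (b + c) + r (a + b + c)))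
        + (r b + (r c + r (b + c))) + (r b + (r (a + c) + r (a + b + c)))
        + (r c + (r (a + b) + r (a + b + c))) + (r (a + b) + (r (a + c) + r (b + c)))"
      by (simp only: l)
    also have "\<dots> = t + t + t" unfolding t_def by (simp only: add_ac)
    also have "\<dots> = s + s + s + s + s + s" unfolding \<open>t = s + s\<close> by (simp only: add_ac)
    finally have "s = 0" by simp
    with \<open>s \<noteq> 0\<close> show ?thesis ..
  qed
qed

text \<open>
  Together with the other \<open>n - 2\<close> pairs as blocks, the six elements of \<open>P = {#p, q#}\<close> and \<open>r ` D\<close>
  can be split in several ways into two further blocks. All blocks obtained in this way have the
  same sum, which yields equations for \<open>p\<close> and \<open>q\<close>. The way of splitting depends on how the class
  of \<open>p\<close> is a sum of classes in \<open>D\<close>.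
\<close>

lemma pair_in_long_minimal_zero_sum:
  assumes U: "minimal_zero_sum U" "set_mset U \<subseteq> C"
    and dec: "sum_list Ps + image_mset r (mset_set D) = U"
    and Ps: "\<forall>P \<in> set Ps. equal_class_pair P" "length Ps = n - 1"
    and D: "card D = 4" "0 \<notin> D" "\<Sum>D = 0" and r: "\<forall>v \<in> D. \<chi> (r v) = v"
    and P: "P \<in> set Ps"
  shows "(\<exists>v\<in>D. P = {#r v, r v#} \<and> r v + r v = sum r D) \<or>
     (\<exists>p. \<exists>v\<in>D. \<exists>w\<in>D. v \<noteq> w \<and> p \<in># P \<and> p = r v + r w)"
proof -
  obtain p q where pq: "P = {#p, q#}" "\<chi> p = \<chi> q" using P Ps by (auto simp: equal_class_pair_def)
  obtain Qs Rs where split: "Ps = Qs @ P # Rs" using P by (meson split_list)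
  let ?R = "\<lambda>E. image_mset r (mset_set E)"
  have PsC: "set_mset B \<subseteq> C" if "B \<in> set Ps" for B
    using set_mset_sum_list[OF that] U(2) unfolding dec[symmetric] by auto
  have PsB: "\<forall>B \<in> set Ps. B \<noteq> {#} \<and> sum_mset B \<in> kernel"
    using equal_class_pair_block PsC Ps by blast
  have rC: "\<forall>v \<in> D. r v \<in> C" using U(2) unfolding dec[symmetric] by auto
  have pqC: "p \<in> C" "q \<in> C" using PsC[OF P] pq by auto
  have len: "length (Qs @ Rs) = n - 2" using Ps(2) split by simp
  have dec': "sum_list (Qs @ Rs) + ({#p, q#} + ?R D) = U"
    using dec unfolding split pq(1) by simp
  have "\<forall>B \<in> set (Qs @ Rs). B \<noteq> {#} \<and> sum_mset B \<in> kernel" using PsB split by auto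
  then obtain c where "\<forall>S T. S + T = {#p, q#} + ?R D \<longrightarrow> S \<noteq> {#} \<longrightarrow> T \<noteq> {#} \<longrightarrow>
        sum_mset S \<in> kernel \<longrightarrow> sum_mset T \<in> kernel \<longrightarrow> sum_mset S = c \<and> c \<noteq> 0"
      using common_block_sum[OF U(1) dec' len] by blast
    then have c: "sum_mset S = c \<and> c \<noteq> 0"
      if "S + T = {#p, q#} + ?R D" "S \<noteq> {#}" "T \<noteq> {#}" "sum_mset S \<in> kernel" "sum_mset T \<in> kernel" for S T
      using that by blast
  have RD: "?R E + ?R (D - E) = ?R D" if "E \<subseteq> D" for E
    using mset_set_Union[of E "D - E"] that by (simp add: Un_absorb1 flip: image_mset_union)
  have Rsum: "sum_mset (?R E) = sum r E" for E by (simp add: sum_unfold_sum_mset)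
  have R\<chi>: "\<chi> (sum r E) = \<Sum>E" if "E \<subseteq> D" for E
  proof -
    have "\<chi> (sum r E) = (\<Sum>v\<in>E. \<chi> (r v))"
      unfolding sum_unfold_sum_mset class_sum_mset by (simp add: image_mset.compositionality comp_def)
    then show ?thesis using r that by (simp add: subset_iff)
  qed
  have RC: "sum r E \<in> C" if "E \<subseteq> D" for E
    using sum_mset_C[of "?R E"] rC that by (auto simp: Rsum)
  have compl: "\<Sum>(D - E) = \<Sum>E" if "E \<subseteq> D" for E
    using D(3) that class_add_eq_0_iff[of "\<Sum>(D - E)" "\<Sum>E"] sum.subset_diff[OF that, of "\<lambda>v. v"] by simp
  \<comment> \<open>Combine \<open>p\<close>, or \<open>q\<close>, with representatives of classes that sum to the class of \<open>p\<close>.\<close>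
  have split1: "p + sum r E = c \<and> c \<noteq> 0" "q + sum r E = c"
    if "E \<subseteq> D" "\<Sum>E = \<chi> p" for E
  proof -
    have "{#p#} + ?R E + ({#q#} + ?R (D - E)) = {#p, q#} + ?R D"
      "{#q#} + ?R E + ({#p#} + ?R (D - E)) = {#p, q#} + ?R D"
      using RD[OF that(1)] by (simp_all flip: RD[OF that(1)])
    note c1 = c[OF this(1)] and c2 = c[OF this(2)]
    show "p + sum r E = c \<and> c \<noteq> 0" "q + sum r E = c"
      using c1 c2 that pq(2) pqC RC[OF that(1)] RC[of "D - E"] R\<chi>[OF that(1)] R\<chi>[of "D - E"] compl[OF that(1)]
      by (auto simp: Rsum kernel_def class_add add_C class_double)
  qed
  have "D \<noteq> {}" using D by auto
  \<comment> \<open>Alternatively, keep \<open>p\<close> and \<open>q\<close> together.\<close>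
  have split2: "p + q = c \<and> sum r D = c"
    using c[of "{#p, q#}" "?R D"] c[of "?R D" "{#p, q#}"] pq(2) pqC RC[of D] R\<chi>[of D] D(3) \<open>D \<noteq> {}\<close>
    by (auto simp: Rsum kernel_def class_add add_C class_double mset_set_empty_iff)
  consider "\<chi> p = 0" | v where "v \<in> D" "\<chi> p = v" | v w where "v \<in> D" "w \<in> D" "v \<noteq> w" "\<chi> p = v + w"
    using class_of_plane[OF D, of "\<chi> p"] by blast
  then show ?thesis
  proof cases
    case 1
    \<comment> \<open>Then \<open>p = q = c\<close> and \<open>p + q = c\<close>, which would give \<open>c = 0\<close>.\<close>
    then have "p = c" "q = c" "c \<noteq> 0" using split1[of "{}"] by auto
    then show ?thesis using split2 by simp
  next
    case 2
    then have "p + r v = c" "q + r v = c" using split1[of "{v}"] by auto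
    with split2 have "p + r v = q + r v" "q + r v = p + q" by simp_all
    then have "p = r v" "q = r v" by simp_all
    then show ?thesis using 2(1) split2 pq(1) by auto
  next
    case 3
    then have "p + (r v + r w) = c" "q + (r v + r w) = c" using split1[of "{v, w}"] by auto
    with split2 have "p + (r v + r w) = q + (r v + r w)" "q + (r v + r w) = p + q" by simp_all
    then have "p = q" "q = r v + r w" by simp_all
    then show ?thesis using 3 pq(1) by auto
  qed
qed

text \<open>
  The first \<open>n - 1\<close> pairs \<open>{#g, g#}\<close> are blocks of \<open>U\<close>, so their \<open>n\<close> partial sums are distinct and
  exhaust the kernel.
\<close>

lemma halves_generate_kernel:
  assumes U: "minimal_zero_sum U" "set_mset U \<subseteq> C" and g: "replicate_mset (2 * n - 1) g \<subset># U"
    and x: "x \<in> kernel"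
  shows "\<exists>i<n. x = sum_mset (replicate_mset (2 * i) g)"
proof -
  define Bs where "Bs = replicate (n - 1) {#g, g#}"
  have take: "sum_list (take i Bs) = replicate_mset (2 * i) g" if "i < n" for i
  proof -
    have "sum_list (replicate i {#g, g#}) = replicate_mset (2 * i) g"
      by (induction i) auto
    then show ?thesis using that by (simp add: Bs_def take_replicate min_def)
  qed
  have "sum_list Bs = replicate_mset (2 * (n - 1)) g"
    using take[of "n - 1"] n_ge_2 by (simp add: Bs_def)
  moreover obtain M where M: "U = replicate_mset (2 * n - 1) g + M"
    using g by (metis mset_subset_eq_exists_conv subset_mset.less_imp_le)
  moreover have "2 * n - 1 = Suc (2 * (n - 1))" using n_ge_2 by simp
  ultimately have dec: "sum_list Bs + add_mset g M = U" by simp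
  have "g \<in> C" using U(2) M n_ge_2 by (auto split: if_splits)
  then have Bs: "\<forall>B \<in> set Bs. B \<noteq> {#} \<and> sum_mset B \<in> kernel"
    by (auto simp: Bs_def kernel_def add_C class_add class_double)
  define f where "f = (\<lambda>i. sum_mset (sum_list (take i Bs)))"
  have f: "inj_on f {..n - 1}" "f ` {..n - 1} \<subseteq> kernel"
    using partial_block_sums[OF U(1) dec _ Bs] by (auto simp: f_def Bs_def)
  then have "card (f ` {..n - 1}) = card kernel"
    using n_ge_2 by (simp add: card_image card_kernel_eq)
  then have "f ` {..n - 1} = kernel" using f(2) finite_kernel by (metis card_subset_eq)
  then obtain i where "i \<le> n - 1" "x = f i" using x by blast
  then show ?thesis using take[of i] n_ge_2 by (intro exI[of _ i]) (auto simp: f_def)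
qed

text \<open>
  The second claim holds because \<open>U\<close> contains \<open>2 * n - 1\<close> copies of \<open>g\<close>. For the first claim, \<open>2 n
  g\<close> lies in the kernel and so equals \<open>2 i g\<close> for some \<open>i < n\<close>; by the second claim, \<open>i = 0\<close>.
\<close>

lemma order_of_half:
  assumes U: "minimal_zero_sum U" "set_mset U \<subseteq> C" and g: "replicate_mset (2 * n - 1) g \<subset># U"
  shows "sum_mset (replicate_mset (2 * n) g) = 0"
    and "0 < j \<Longrightarrow> j < 2 * n \<Longrightarrow> sum_mset (replicate_mset j g) \<noteq> 0"
proof -
  have nz: "sum_mset (replicate_mset j g) \<noteq> 0" if "0 < j" "j < 2 * n" for j
  proof -
    have "replicate_mset j g \<subseteq># replicate_mset (2 * n - 1) g"
      using that by (simp add: replicate_mset_msubseteq_iff)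
    then have "replicate_mset j g \<subset># U" using g by (rule subset_mset.le_less_trans)
    moreover have "replicate_mset j g \<noteq> {#}" using that by simp
    ultimately show ?thesis using minimal_zero_sum_sub[OF U(1)] by blast
  qed
  then show "0 < j \<Longrightarrow> j < 2 * n \<Longrightarrow> sum_mset (replicate_mset j g) \<noteq> 0" .
  have "g \<in># replicate_mset (2 * n - 1) g" using n_ge_2 by simp
  then have "g \<in># U" using g by (meson mset_subset_eqD subset_mset.less_imp_le)
  then have gC: "g \<in> C" using U(2) by auto
  have "sum_mset (replicate_mset (2 * n) g) \<in> kernel"
  proof -
    have "sum_mset (replicate_mset (2 * m) g) \<in> kernel" for m
    proof (induction m)
      case (Suc m)
      have "g + g \<in> kernel" using gC by (simp add: kernel_def add_C class_add class_double)
      from kernel_add[OF this Suc] show ?case by (simp add: add.assoc)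
    qed (simp add: kernel_def zero_C)
    then show ?thesis .
  qed
  then obtain i where i: "i < n" "sum_mset (replicate_mset (2 * n) g) = sum_mset (replicate_mset (2 * i) g)"
    using halves_generate_kernel[OF U g] by blast
  have "2 * n = 2 * i + (2 * n - 2 * i)" using i by simp
  then have "sum_mset (replicate_mset (2 * n - 2 * i) g) = 0"
    using i(2) sum_replicate_mset_add[of "2 * i" "2 * n - 2 * i" g] by (metis add_cancel_left_right)
  then have "\<not> 2 * n - 2 * i < 2 * n" using nz[of "2 * n - 2 * i"] i(1) by auto
  then have "i = 0" using i(1) by linarith
  then show "sum_mset (replicate_mset (2 * n) g) = 0" using i(2) by simp
qed

text \<open>
  By \<open>pair_in_long_minimal_zero_sum\<close>, either a pair contains the sum of two of the four
  representatives \<open>r v\<close>, or every pair is \<open>{#r v, r v#}\<close> for a class \<open>v\<close> with \<open>2 (r v) = sum r D\<close>.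
  In the latter case two different pairs give the second shape, and otherwise all pairs are equal,
  which is the third shape.
\<close>

lemma long_minimal_zero_sum_structure:
  assumes U: "minimal_zero_sum U" "set_mset U \<subseteq> C" and long: "size U \<ge> 2 * n + 2"
  shows "size U = 2 * n + 2" (is ?size)
    and "(\<exists>f g h. {#f, g, h#} \<subseteq># U \<and> f = g + h) \<or>
      (\<exists>g h k l. {#g, h, k, l#} \<subseteq># U \<and> distinct [g, h, k, l] \<and>
         g + g = h + h \<and> g + g = g + (h + (k + l))) \<or>
      (\<exists>g h k l. U = replicate_mset (2 * n - 1) g + {#h, k, l#} \<and>
         distinct [0, \<chi> g, \<chi> h, \<chi> k, \<chi> l] \<and> g + g = g + (h + (k + l)))" (is ?cases)
proof -
  obtain Ps D r where dec: "sum_list Ps + image_mset r (mset_set D) = U"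
    and Ps: "\<forall>P \<in> set Ps. equal_class_pair P" "length Ps = n - 1"
    and D: "card D = 4" "0 \<notin> D" "\<Sum>D = 0" and r: "\<forall>v \<in> D. \<chi> (r v) = v"
    by (rule long_minimal_zero_sum_split[OF U long])
  have "size P = 2" if "P \<in> set Ps" for P
    using that Ps(1) by (auto simp: equal_class_pair_def)
  then show ?size using sum_list_pairs_size[of Ps] Ps(2) D(1) n_ge_2 by (auto simp: dec[symmetric])
  have inj: "r v = r w \<longleftrightarrow> v = w" if "v \<in> D" "w \<in> D" for v w using r that by metis
  note pair = pair_in_long_minimal_zero_sum[OF U dec Ps D r]
  show ?cases
  proof (cases "\<exists>P\<in>set Ps. \<exists>p. \<exists>v\<in>D. \<exists>w\<in>D. v \<noteq> w \<and> p \<in># P \<and> p = r v + r w")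
    case True
    then obtain P p v w where p: "P \<in> set Ps" "v \<in> D" "w \<in> D" "v \<noteq> w" "p \<in># P" "p = r v + r w" by blast
    have "{#p#} \<subseteq># sum_list Ps" using p set_mset_sum_list[OF p(1)] by auto
    moreover have "{#r v, r w#} \<subseteq># image_mset r (mset_set D)"
    proof -
      have "mset_set D = add_mset v (add_mset w (mset_set (D - {v} - {w})))"
        using p(2-4) by (simp add: mset_set.remove)
      then show ?thesis by simp
    qed
    ultimately have "{#p#} + {#r v, r w#} \<subseteq># U" unfolding dec[symmetric] by (rule subset_mset.add_mono)
    then have "{#p, r v, r w#} \<subseteq># U" by (simp add: add_mset_commute)
    with p(6) show ?thesis by blast
  next
    case False
    then have doubled: "\<exists>v\<in>D. P = {#r v, r v#} \<and> r v + r v = sum r D" if "P \<in> set Ps" for P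
      using pair[OF that] that by metis
    have "length Ps \<noteq> 0" using Ps(2) n_ge_2 by simp
    then obtain P where P: "P \<in> set Ps" by (cases Ps) auto
    then obtain v where v: "v \<in> D" "P = {#r v, r v#}" "r v + r v = sum r D" using doubled by blast
    show ?thesis
    proof (cases "\<exists>Q\<in>set Ps. Q \<noteq> P")
      case True
      then obtain w where w: "w \<in> D" "r w + r w = sum r D" "w \<noteq> v" using doubled v by blast
      have "card (D - {v, w}) = 2" using D(1) v(1) w by (simp add: card_Diff_subset)
      then obtain x y where "D - {v, w} = {x, y}" "x \<noteq> y" by (meson card_2_iff)
      then have xy: "D = {v, w, x, y}" "distinct [v, w, x, y]" using v(1) w by auto
      then have "image_mset r (mset_set D) = {#r v, r w, r x, r y#}" by simp
      then have "{#r v, r w, r x, r y#} \<subseteq># U" using dec by (metis mset_subset_eq_add_right)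
      moreover have "distinct [r v, r w, r x, r y]" using xy inj by simp
      moreover have "sum r D = r v + (r w + (r x + r y))" using xy by simp
      ultimately have "{#r v, r w, r x, r y#} \<subseteq># U \<and> distinct [r v, r w, r x, r y] \<and>
          r v + r v = r w + r w \<and> r v + r v = r v + (r w + (r x + r y))"
        using v(3) w(2) by simp
      then show ?thesis by blast
    next
      case False
      then have "Q = {#r v, r v#}" if "Q \<in> set Ps" for Q using v that by blast
      with Ps(2) have "Ps = replicate (n - 1) {#r v, r v#}" by (intro replicate_eqI) auto
      moreover have "sum_list (replicate i {#g, g#}) = replicate_mset (2 * i) g" for i and g :: 'a
        by (induction i) auto
      ultimately have s: "sum_list Ps = replicate_mset (2 * (n - 1)) (r v)" by simp
      have "card (D - {v}) = 3" using D(1) v(1) by simp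
      then obtain w x y where "D - {v} = {w, x, y}" "w \<noteq> x" "w \<noteq> y" "x \<noteq> y" by (auto simp: card_3_iff)
      then have xy: "D = {v, w, x, y}" "distinct [v, w, x, y]" using v(1) by auto
      then have "image_mset r (mset_set D) = {#r v, r w, r x, r y#}" by simp
      then have "U = replicate_mset (2 * (n - 1)) (r v) + {#r v, r w, r x, r y#}" using dec s by simp
      also have "\<dots> = replicate_mset (Suc (2 * (n - 1))) (r v) + {#r w, r x, r y#}" by simp
      also have "Suc (2 * (n - 1)) = 2 * n - 1" using n_ge_2 by simp
      finally have "U = replicate_mset (2 * n - 1) (r v) + {#r w, r x, r y#}" .
      moreover have "distinct [0, \<chi> (r v), \<chi> (r w), \<chi> (r x), \<chi> (r y)]" using xy r D(2) by auto
      moreover have "sum r D = r v + (r w + (r x + r y))" using xy by simp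
      ultimately have "U = replicate_mset (2 * n - 1) (r v) + {#r w, r x, r y#} \<and>
          distinct [0, \<chi> (r v), \<chi> (r w), \<chi> (r x), \<chi> (r y)] \<and> r v + r v = r v + (r w + (r x + r y))"
        using v(3) by simp
      then show ?thesis by blast
    qed
  qed
qed

end

section \<open>Relations between lengths coming from a long minimal zero-sum sequence\<close>

lemma minimal_zero_sumI:
  assumes "V \<noteq> {#}" "sum_mset V = 0"
    and "\<And>W. W \<subseteq># V \<Longrightarrow> W \<noteq> {#} \<Longrightarrow> size W < size V \<Longrightarrow> sum_mset W \<noteq> 0"
  shows "minimal_zero_sum V"
  unfolding minimal_zero_sum_def
  using assms by (metis mset_subset_size subset_mset.le_imp_less_or_eq)

lemma sum_mset_complement_zero:
  assumes "W \<subseteq># V" "sum_mset V = (0::'a::ab_group_add)" "sum_mset W = 0"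
  shows "sum_mset (V - W) = 0"
  using assms by (metis add_0 subset_mset.add_diff_inverse sum_mset.union)

lemma zero_sum_size_1:
  assumes "sum_mset A = (0::'a::ab_group_add)" "0 \<notin># A"
  shows "size A \<noteq> 1"
proof
  assume "size A = 1"
  then obtain x where "A = {#x#}" using size_1_singleton_mset by blast
  with assms show False by simp
qed

lemma minimal_zero_sum_3:
  assumes "sum_mset V = (0::'a::ab_group_add)" "size V = 3" "0 \<notin># V"
  shows "minimal_zero_sum V"
proof (rule minimal_zero_sumI)
  fix W assume W: "W \<subseteq># V" "W \<noteq> {#}" "size W < size V"
  show "sum_mset W \<noteq> 0"
  proof
    assume z: "sum_mset W = 0"
    have one: "size A \<noteq> 1" if "A \<subseteq># V" "sum_mset A = 0" for A
      using zero_sum_size_1[OF that(2)] that(1) assms(3) by (meson mset_subset_eqD)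
    have "size W \<noteq> 0" using W(2) by simp
    moreover have "size W + size (V - W) = 3"
      using size_mset_mono[OF W(1)] W(1) assms(2) by (simp add: size_Diff_submset)
    moreover have "size W \<noteq> 1" "size (V - W) \<noteq> 1"
      using one[OF W(1) z] one[of "V - W"] sum_mset_complement_zero[OF W(1) assms(1) z] by auto
    ultimately show False using W(3) assms(2) by linarith
  qed
qed (use assms in auto)

text \<open>
  If two of the four elements have sum zero, then so do the other two. This is why only the pairs
  containing \<open>a\<close> have to be checked.
\<close>

lemma minimal_zero_sum_4:
  assumes zero: "a + (b + (c + d)) = (0::'a::ab_group_add)"
    and nonzero: "a \<noteq> 0" "b \<noteq> 0" "c \<noteq> 0" "d \<noteq> 0"
    and pairs: "a + b \<noteq> 0" "a + c \<noteq> 0" "a + d \<noteq> 0"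
  shows "minimal_zero_sum {#a, b, c, d#}"
proof (rule minimal_zero_sumI)
  let ?V = "{#a, b, c, d#}"
  show z0: "sum_mset ?V = 0" using zero by simp
  fix W assume W: "W \<subseteq># ?V" "W \<noteq> {#}" "size W < size ?V"
  show "sum_mset W \<noteq> 0"
  proof
    assume z: "sum_mset W = 0"
    have one: "size A \<noteq> 1" if "A \<subseteq># ?V" "sum_mset A = 0" for A
    proof -
      have "0 \<notin># ?V" using nonzero by auto
      then show ?thesis using zero_sum_size_1[OF that(2)] that(1) by (meson mset_subset_eqD)
    qed
    have two: "a \<notin># A" if "A \<subseteq># ?V" "sum_mset A = 0" "size A = 2" for A
    proof
      assume "a \<in># A"
      then obtain A' where A': "A = add_mset a A'" by (meson multi_member_split)
      then have "size A' = 1" using that(3) by simp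
      then obtain y where y: "A' = {#y#}" using size_1_singleton_mset by blast
      then have "y \<in># {#b, c, d#}" using that(1) A' by auto
      moreover have "a + y = 0" using that(2) A' y by simp
      ultimately show False using pairs by auto
    qed
    have "size W + size (?V - W) = 4"
      using size_mset_mono[OF W(1)] W(1) by (simp add: size_Diff_submset)
    have "size W \<noteq> 2"
    proof
      assume "size W = 2"
      then have "a \<notin># W" "a \<notin># ?V - W"
        using two[OF W(1) z] two[of "?V - W"] sum_mset_complement_zero[OF W(1) z0 z]
          \<open>size W + size (?V - W) = 4\<close> by auto
      moreover have "a \<in># W + (?V - W)" using W(1) by (simp add: subset_mset.add_diff_inverse)
      ultimately show False by simp
    qed
    moreover have "size W \<noteq> 0" using W(2) by simp
    moreover note \<open>size W + size (?V - W) = 4\<close>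
    moreover have "size W \<noteq> 1" "size (?V - W) \<noteq> 1"
      using one[OF W(1) z] one[of "?V - W"] sum_mset_complement_zero[OF W(1) z0 z] by auto
    moreover have "size W < 4" using W(3) by simp
    ultimately show False by linarith
  qed
qed auto

lemma minimal_zero_sum_nonzero:
  assumes "minimal_zero_sum U" "size U \<ge> 2"
  shows "0 \<notin># U"
  using zero_in_minimal_zero_sum[OF assms(1)] assms(2) by force

text \<open>
  The two lengths come from \<open>((-f) g h) (f (-g) (-h)) = (f (-f)) (g (-g)) (h (-h))\<close>.
\<close>

lemma lengths_sum_of_two:
  assumes "0 \<notin># {#f, g, h#}" "f = g + (h::'a::ab_group_add)"
  shows "2 \<in> factorization_lengths ({#f, g, h#} + neg_seq {#f, g, h#})"
    and "3 \<in> factorization_lengths ({#f, g, h#} + neg_seq {#f, g, h#})"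
proof -
  have "minimal_zero_sum {#-f, g, h#}" using assms by (intro minimal_zero_sum_3) auto
  then have "1 + 1 \<in> factorization_lengths ({#-f, g, h#} + neg_seq {#-f, g, h#})"
    by (intro factorization_lengths_add minimal_zero_sum_length_1 minimal_zero_sum_neg)
  moreover have "{#-f, g, h#} + neg_seq {#-f, g, h#} = {#f, g, h#} + neg_seq {#f, g, h#}"
    by (simp add: add_mset_commute)
  ultimately show "2 \<in> factorization_lengths ({#f, g, h#} + neg_seq {#f, g, h#})" 
    by (simp only: one_add_one)
  show "3 \<in> factorization_lengths ({#f, g, h#} + neg_seq {#f, g, h#})"
    using factorization_lengths_pairs[OF assms(1)] by (simp add: eval_nat_numeral)
qed

lemma minimal_zero_sum_switch:
  assumes "0 \<notin># {#g, h, k, l#}" "g \<notin># {#h, k, l#}" "g = h + (k + (l :: 'a::ab_group_add))"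
  shows "minimal_zero_sum {#-g, h, k, l#}"
proof (rule minimal_zero_sum_4)
  show "- g + (h + (k + l)) = 0" using assms(3) by simp
qed (use assms(1,2) in auto)

text \<open>
  The hypotheses give \<open>g = h + k + l\<close> and \<open>h = g + k + l\<close>. The two lengths come from \<open>((-g) h k l)
  (h (-g) (-k) (-l)) = (h h (-g) (-g)) (k (-k)) (l (-l))\<close>.
\<close>

lemma lengths_two_halves:
  assumes nz: "0 \<notin># {#g, h, k, l#}" and dist: "distinct [g, h, k, l]"
    and eq: "g + g = h + h" "g + g = g + (h + (k + (l :: 'a::ab_group_add)))" and gg: "g + g \<noteq> 0"
  shows "2 \<in> factorization_lengths ({#h, h, k, l#} + neg_seq {#g, g, k, l#})"
    and "3 \<in> factorization_lengths ({#h, h, k, l#} + neg_seq {#g, g, k, l#})"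
proof -
  have g: "g = h + (k + l)" using eq(2) by simp
  have "h + (g + (k + l)) = g + (h + (k + l))" by (simp only: add_ac)
  also have "\<dots> = h + h" using eq by simp
  finally have h: "h = g + (k + l)" by simp
  have "minimal_zero_sum {#-g, h, k, l#}"
    using nz dist by (intro minimal_zero_sum_switch[OF _ _ g]) auto
  moreover have "minimal_zero_sum {#-h, g, k, l#}"
    using nz dist by (intro minimal_zero_sum_switch[OF _ _ h]) auto
  ultimately have "1 + 1 \<in> factorization_lengths ({#-g, h, k, l#} + neg_seq {#-h, g, k, l#})"
    by (intro factorization_lengths_add minimal_zero_sum_length_1 minimal_zero_sum_neg)
  moreover have "{#-g, h, k, l#} + neg_seq {#-h, g, k, l#} = {#h, h, k, l#} + neg_seq {#g, g, k, l#}"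
    by (simp add: add_mset_commute)
  ultimately show "2 \<in> factorization_lengths ({#h, h, k, l#} + neg_seq {#g, g, k, l#})"
    by (simp only: one_add_one)
  have "minimal_zero_sum {#h, h, -g, -g#}"
  proof (rule minimal_zero_sum_4)
    show "h + (h + (- g + - g)) = 0" using eq(1) by (simp add: algebra_simps)
    show "h \<noteq> 0" "h \<noteq> 0" "- g \<noteq> 0" "- g \<noteq> 0" using nz by auto
    show "h + - g \<noteq> 0" "h + - g \<noteq> 0" using dist by auto
    show "h + h \<noteq> 0" using gg unfolding eq(1) .
  qed
  then have "1 + (1 + 1) \<in> factorization_lengths ({#h, h, -g, -g#} + ({#k, -k#} + {#l, -l#}))"
    using nz by (intro factorization_lengths_add minimal_zero_sum_length_1 minimal_zero_sum_pair) auto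
  moreover have "{#h, h, -g, -g#} + ({#k, -k#} + {#l, -l#}) = {#h, h, k, l#} + neg_seq {#g, g, k, l#}"
    by (simp add: add_mset_commute)
  ultimately show "3 \<in> factorization_lengths ({#h, h, k, l#} + neg_seq {#g, g, k, l#})"
    by (simp add: numeral_3_eq_3 add_mset_commute)
qed

lemma minimal_zero_sum_replicate:
  assumes "sum_mset (replicate_mset m g) = 0" "m > 0"
    and "\<And>i. 0 < i \<Longrightarrow> i < m \<Longrightarrow> sum_mset (replicate_mset i g) \<noteq> 0"
  shows "minimal_zero_sum (replicate_mset m (g :: 'a::ab_group_add))"
proof (rule minimal_zero_sumI)
  fix W assume W: "W \<subseteq># replicate_mset m g" "W \<noteq> {#}" "size W < size (replicate_mset m g)"
  then obtain i where "i \<le> m" "W = replicate_mset i g" by (auto elim: msubseteq_replicate_msetE)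
  then show "sum_mset W \<noteq> 0" using assms(3)[of i] W by simp
qed (use assms in auto)

context class_map
begin

lemma class_uminus: "\<chi> (- x) = \<chi> x"
  using class_add[of x "- x"] class_add_eq_0_iff[of "\<chi> x" "\<chi> (- x)"] by simp

lemma class_sum_replicate: "\<chi> (sum_mset (replicate_mset j x)) \<in> {0, \<chi> x}"
  by (induction j) (auto simp: class_add class_double)

text \<open>
  A subsequence containing \<open>h\<close> exactly once has nonzero sum, because its class is \<open>\<chi> h\<close> or \<open>\<chi> h +
  \<chi> x\<close>.
\<close>

lemma minimal_zero_sum_double_replicate:
  assumes zero: "h + h + sum_mset (replicate_mset j x) = 0"
    and nz: "\<And>i. 0 < i \<Longrightarrow> i \<le> j \<Longrightarrow> sum_mset (replicate_mset i x) \<noteq> 0"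
    and cls: "\<chi> h \<noteq> 0" "\<chi> h \<noteq> \<chi> x"
  shows "minimal_zero_sum ({#h, h#} + replicate_mset j x)"
proof (rule minimal_zero_sumI)
  show "sum_mset ({#h, h#} + replicate_mset j x) = 0" using zero by (simp add: add.assoc)
  fix W assume W: "W \<subseteq># {#h, h#} + replicate_mset j x" "W \<noteq> {#}"
    "size W < size ({#h, h#} + replicate_mset j x)"
  have hx: "h \<noteq> x" using cls by auto
  define i where "i = count W x"
  define m where "m = count W h"
  have im: "i \<le> j" "m \<le> 2"
    using mset_subset_eq_count[OF W(1), of x] mset_subset_eq_count[OF W(1), of h] hx
    by (auto simp: i_def m_def)
  have Weq: "W = replicate_mset m h + replicate_mset i x"
  proof (rule multiset_eqI)
    fix y
    show "count W y = count (replicate_mset m h + replicate_mset i x) y"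
      using mset_subset_eq_count[OF W(1), of y] hx by (auto simp: i_def m_def split: if_splits)
  qed
  consider "m = 0" | "m = 1" | "m = 2" using im(2) by linarith
  then show "sum_mset W \<noteq> 0"
  proof cases
    case 1
    then show ?thesis using W(2) Weq nz[of i] im(1) by simp
  next
    case 2
    then have "\<chi> (sum_mset W) \<in> {\<chi> h, \<chi> h + \<chi> x}"
      using class_sum_replicate[of i x] Weq by (auto simp: class_add)
    then have "\<chi> (sum_mset W) \<noteq> 0" using cls class_add_eq_0_iff by auto
    then show ?thesis by auto
  next
    case 3
    then have ij: "i < j" using W(3) Weq by simp
    have "h + h + sum_mset (replicate_mset (i + (j - i)) x) = 0" using zero ij by simp
    then have "sum_mset W + sum_mset (replicate_mset (j - i) x) = 0"
      unfolding sum_replicate_mset_add using Weq 3 by (simp add: numeral_2_eq_2 add.assoc)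
    then show ?thesis using nz[of "j - i"] ij by auto
  qed
qed auto

text \<open>
  In multiplicative notation, with \<open>2 h = 2 i g\<close>, the two lengths come from \<open>(h\<^sup>2 (-g)\<^bsup>2i\<^esup>) g\<^bsup>2n\<^esup>
  = (h\<^sup>2 g\<^bsup>2n - 2i\<^esup>) (g (-g))\<^bsup>2i\<^esup>\<close>.
\<close>

lemma lengths_one_half:
  assumes order: "sum_mset (replicate_mset (2 * n) g) = 0"
    "\<And>j. 0 < j \<Longrightarrow> j < 2 * n \<Longrightarrow> sum_mset (replicate_mset j g) \<noteq> 0"
    and i: "0 < i" "i < n" "h + h = sum_mset (replicate_mset (2 * i) g)"
    and cls: "\<chi> h \<noteq> 0" "\<chi> h \<noteq> \<chi> g"
  shows "2 \<in> factorization_lengths ({#h, h#} + replicate_mset (2 * n) g + neg_seq (replicate_mset (2 * i) g))"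
    and "1 + 2 * i \<in> factorization_lengths ({#h, h#} + replicate_mset (2 * n) g + neg_seq (replicate_mset (2 * i) g))"
proof -
  have neg: "sum_mset (replicate_mset m (- g)) = - sum_mset (replicate_mset m g)" for m
    using sum_mset_neg_seq[of "replicate_mset m g"] by simp
  have "minimal_zero_sum ({#h, h#} + replicate_mset (2 * i) (- g))"
    using i order(2) cls by (intro minimal_zero_sum_double_replicate) (auto simp: neg class_uminus)
  moreover have "minimal_zero_sum (replicate_mset (2 * n) g)"
    using order i by (intro minimal_zero_sum_replicate) auto
  ultimately have "1 + 1 \<in> factorization_lengths
      ({#h, h#} + replicate_mset (2 * i) (- g) + replicate_mset (2 * n) g)"
    by (intro factorization_lengths_add minimal_zero_sum_length_1)
  then show "2 \<in> factorization_lengths ({#h, h#} + replicate_mset (2 * n) g + neg_seq (replicate_mset (2 * i) g))"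
    by (simp add: add_ac numeral_2_eq_2)
  have n: "2 * n = 2 * i + (2 * n - 2 * i)" using i by simp
  then have "sum_mset (replicate_mset (2 * i) g) + sum_mset (replicate_mset (2 * n - 2 * i) g) = 0"
    using order(1) sum_replicate_mset_add by metis
  then have "minimal_zero_sum ({#h, h#} + replicate_mset (2 * n - 2 * i) g)"
    using i order(2) cls by (intro minimal_zero_sum_double_replicate) auto
  moreover have "0 \<notin># replicate_mset (2 * i) g"
    using order(2)[of 1] i by auto
  then have "2 * i \<in> factorization_lengths (replicate_mset (2 * i) g + neg_seq (replicate_mset (2 * i) g))"
    using factorization_lengths_pairs[of "replicate_mset (2 * i) g"] by simp
  ultimately have "1 + 2 * i \<in> factorization_lengths ({#h, h#} + replicate_mset (2 * n - 2 * i) g +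
      (replicate_mset (2 * i) g + neg_seq (replicate_mset (2 * i) g)))"
    by (intro factorization_lengths_add minimal_zero_sum_length_1)
  moreover have *: "replicate_mset (2 * n - 2 * i) g + replicate_mset (2 * i) g = replicate_mset (2 * n) g"
    using i by (intro multiset_eqI) auto
  ultimately show "1 + 2 * i \<in> factorization_lengths ({#h, h#} + replicate_mset (2 * n) g + neg_seq (replicate_mset (2 * i) g))"
    by (simp only: add.assoc flip: *)
qed

text \<open>
  In the first two shapes of \<open>long_minimal_zero_sum_structure\<close> there is a relation between the
  lengths \<open>2\<close> and \<open>3\<close>. In the third shape, one relation has lengths \<open>2\<close> and \<open>4\<close>, and another one
  has the lengths \<open>2\<close> and \<open>2 i + 1\<close>, so that \<open>d\<close> divides both \<open>2\<close> and an odd number.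
\<close>

lemma long_minimal_zero_sum_difference:
  assumes U: "minimal_zero_sum U" "set_mset U \<subseteq> C" and long: "size U \<ge> 2 * n + 2"
    and d: "\<And>E k l. E \<subseteq># (U + U) + neg_seq (U + U) \<Longrightarrow>
      k \<in> factorization_lengths E \<Longrightarrow> l \<in> factorization_lengths E \<Longrightarrow> int d dvd int k - int l"
  shows "d = 1"
proof -
  have sub: "A + neg_seq B \<subseteq># (U + U) + neg_seq (U + U)"
    if "A \<subseteq># (U + U)" "B \<subseteq># (U + U)" for A B
    using subset_mset.add_mono[OF that(1) image_mset_subseteq_mono[OF that(2)]] .
  have once: "A \<subseteq># (U + U)" if "A \<subseteq># U" for A
    by (rule subset_mset.order_trans[OF that mset_subset_eq_add_left])
  have one: "d = 1" if "A \<subseteq># (U + U)" "B \<subseteq># (U + U)"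
    "2 \<in> factorization_lengths (A + neg_seq B)" "3 \<in> factorization_lengths (A + neg_seq B)" for A B
    using d[OF sub[OF that(1,2)] that(4,3)] by simp
  have nz: "0 \<notin># U" using minimal_zero_sum_nonzero[OF U(1)] long by simp
  from long_minimal_zero_sum_structure(2)[OF U long] show ?thesis
  proof (elim disjE exE conjE)
    fix f g h assume 1: "{#f, g, h#} \<subseteq># U" "f = g + h"
    have "0 \<notin># {#f, g, h#}" using nz 1(1) by (meson mset_subset_eqD)
    then show ?thesis
      using one[OF once[OF 1(1)] once[OF 1(1)]] lengths_sum_of_two[OF _ 1(2)] by simp
  next
    fix g h k l assume 2: "{#g, h, k, l#} \<subseteq># U" "distinct [g, h, k, l]"
      "g + g = h + h" "g + g = g + (h + (k + l))"
    have nz4: "0 \<notin># {#g, h, k, l#}" using nz 2(1) by (meson mset_subset_eqD)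
    have gg: "g + g \<noteq> 0"
    proof -
      have "size {#g, h, k, l#} \<noteq> size U" using long n_ge_2 by simp
      then have "{#g, h, k, l#} \<noteq> U" by metis
      with 2(1) have "{#g, h, k, l#} \<subset># U" by (rule subset_mset.le_neq_trans)
      then have "g + (h + (k + l)) \<noteq> 0" using minimal_zero_sum_sub[OF U(1)] by fastforce
      then show ?thesis unfolding 2(4) by simp
    qed
    have sub2: "{#h, h, k, l#} \<subseteq># (U + U)" "{#g, g, k, l#} \<subseteq># (U + U)"
    proof -
      have "{#g, h, k, l#} + {#g, h, k, l#} \<subseteq># (U + U)"
        by (rule subset_mset.add_mono[OF 2(1) 2(1)])
      moreover have "{#g, h, k, l#} + {#g, h, k, l#} = {#h, h, k, l#} + {#g, g, k, l#}"
        by (simp add: add_mset_commute)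
      ultimately have *: "{#h, h, k, l#} + {#g, g, k, l#} \<subseteq># U + U" by (simp only:)
      show "{#h, h, k, l#} \<subseteq># (U + U)"
        by (rule subset_mset.order_trans[OF mset_subset_eq_add_left *])
      show "{#g, g, k, l#} \<subseteq># (U + U)"
        by (rule subset_mset.order_trans[OF mset_subset_eq_add_right *])
    qed
    show ?thesis by (rule one[OF sub2 lengths_two_halves[OF nz4 2(2-4) gg]])
  next
    fix g h k l assume 3: "U = replicate_mset (2 * n - 1) g + {#h, k, l#}"
      "distinct [0, \<chi> g, \<chi> h, \<chi> k, \<chi> l]" "g + g = g + (h + (k + l))"
    have g: "replicate_mset (2 * n - 1) g \<subset># U" unfolding 3(1) by (auto simp: subset_mset_def)
    note order = order_of_half[OF U g]
    have ghkl: "{#g, h, k, l#} \<subseteq># U"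
    proof -
      have "{#g#} \<subseteq># replicate_mset (2 * n - 1) g" using n_ge_2 by simp
      then have "{#g#} + {#h, k, l#} \<subseteq># U" unfolding 3(1) by (rule subset_mset.add_right_mono)
      then show ?thesis by (simp add: add_mset_commute)
    qed
    have nz4: "0 \<notin># {#g, h, k, l#}" using nz ghkl by (meson mset_subset_eqD)
    \<comment> \<open>\<open>((-g) h k l) (g (-h) (-k) (-l))\<close> is also a product of four pairs, so \<open>d\<close> divides \<open>2\<close>.\<close>
    have "g \<notin># {#h, k, l#}" using 3(2) by auto
    moreover have "g = h + (k + l)" using 3(3) by simp
    ultimately have "minimal_zero_sum {#-g, h, k, l#}" by (rule minimal_zero_sum_switch[OF nz4])
    then have "1 + 1 \<in> factorization_lengths ({#-g, h, k, l#} + neg_seq {#-g, h, k, l#})"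
      by (intro factorization_lengths_add minimal_zero_sum_length_1 minimal_zero_sum_neg)
    moreover have "{#-g, h, k, l#} + neg_seq {#-g, h, k, l#} = {#g, h, k, l#} + neg_seq {#g, h, k, l#}"
      by (simp add: add_mset_commute)
    ultimately have "2 \<in> factorization_lengths ({#g, h, k, l#} + neg_seq {#g, h, k, l#})"
      by (simp only: one_add_one)
    moreover have "4 \<in> factorization_lengths ({#g, h, k, l#} + neg_seq {#g, h, k, l#})"
      using factorization_lengths_pairs[OF nz4] by (simp add: eval_nat_numeral)
    ultimately have d2: "int d dvd 2"
      using d[OF sub[OF once[OF ghkl] once[OF ghkl]], of 4 2] by simp
    \<comment> \<open>If \<open>h\<close>, \<open>k\<close>, \<open>l\<close> all had order two, then so would \<open>g = h + k + l\<close>, but \<open>g\<close> has order \<open>2 n\<close>.\<close>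
    have "\<exists>y\<in>{h, k, l}. y + y \<noteq> 0"
    proof (rule ccontr)
      assume "\<not> ?thesis"
      moreover have "g + g = (h + h) + ((k + k) + (l + l))" using 3(3) by (simp add: add_ac)
      ultimately have "g + g = 0" by simp
      then show False using order(2)[of 2] n_ge_2 by (simp add: numeral_2_eq_2)
    qed
    then obtain y where y: "y \<in> {h, k, l}" "y + y \<noteq> 0" by blast
    have "y \<in> C" using y(1) U(2) unfolding 3(1) by auto
    then have "y + y \<in> kernel" by (simp add: kernel_def add_C class_add class_double)
    then obtain i where i: "i < n" "y + y = sum_mset (replicate_mset (2 * i) g)"
      using halves_generate_kernel[OF U g] by blast
    then have "0 < i" using y(2) by (cases i) auto
    have cls: "\<chi> y \<noteq> 0" "\<chi> y \<noteq> \<chi> g" using 3(2) y(1) by auto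
    have "{#y, y#} + replicate_mset (2 * n) g \<subseteq># (U + U)"
    proof -
      let ?A = "replicate_mset (2 * n - 1) g + {#y#}"
      have "?A \<subseteq># U" unfolding 3(1) using y(1) by (intro subset_mset.add_left_mono) auto
      then have "?A + ?A \<subseteq># U + U" by (intro subset_mset.add_mono)
      moreover have "g \<noteq> y" using cls by blast
      then have "{#y, y#} + replicate_mset (2 * n) g \<subseteq># ?A + ?A"
        using n_ge_2 by (auto simp: subseteq_mset_def)
      ultimately show ?thesis by (rule subset_mset.order_trans[rotated])
    qed
    moreover have "replicate_mset (2 * i) g \<subseteq># replicate_mset (2 * n - 1) g"
      using i(1) by (auto simp: replicate_mset_msubseteq_iff)
    then have "replicate_mset (2 * i) g \<subseteq># (U + U)"
      using g by (intro once) (meson subset_mset.less_imp_le subset_mset.order_trans)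
    ultimately have "int d dvd int (1 + 2 * i) - int 2"
      using d[OF sub lengths_one_half(2,1)[OF order \<open>0 < i\<close> i cls]] by simp
    then have "int d dvd (1 + 2 * int i) - 2" by simp
    moreover have "int d dvd 2 * (int i - 1)" using d2 by simp
    ultimately have "int d dvd (1 + 2 * int i) - 2 - 2 * (int i - 1)" by (rule dvd_diff)
    then show ?thesis by simp
  qed
qed

end

section \<open>Elasticity\<close>

text \<open>
  The zero element forms an atom of length \<open>1\<close>. Counting it twice makes every atom have weight at
  least \<open>2\<close>, while the largest weight of an atom is still the largest length.
\<close>

definition weight :: "'a::ab_group_add multiset \<Rightarrow> nat" where
  "weight S = size S + count S 0"

lemma weight_add: "weight (S + T) = weight S + weight T"
  by (simp add: weight_def)

lemma weight_Union: "weight (\<Sum>\<^sub># \<V>) = (\<Sum>V\<in>#\<V>. weight V)"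
  by (induction \<V>) (simp_all add: weight_add, simp add: weight_def)

lemma sum_mset_ge_const:
  fixes f :: "'c \<Rightarrow> nat"
  assumes "\<forall>V \<in># \<V>. c \<le> f V"
  shows "c * size \<V> \<le> (\<Sum>V\<in>#\<V>. f V)"
    and "(\<Sum>V\<in>#\<V>. f V) = c * size \<V> \<Longrightarrow> V \<in># \<V> \<Longrightarrow> f V = c"
proof -
  have ge: "(\<forall>V \<in># M. c \<le> f V) \<Longrightarrow> c * size M \<le> (\<Sum>V\<in>#M. f V)" for M
    by (induction M) auto
  then show "c * size \<V> \<le> (\<Sum>V\<in>#\<V>. f V)" using assms by blast
  assume eq: "(\<Sum>V\<in>#\<V>. f V) = c * size \<V>" and V: "V \<in># \<V>"
  then obtain M where M: "\<V> = add_mset V M" by (meson multi_member_split)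
  have "c * size M \<le> (\<Sum>V\<in>#M. f V)" using ge[of M] assms M by auto
  then show "f V = c" using eq assms M by auto
qed

lemma sum_mset_le_const:
  fixes f :: "'c \<Rightarrow> nat"
  assumes "\<forall>V \<in># \<V>. f V \<le> c"
  shows "(\<Sum>V\<in>#\<V>. f V) \<le> c * size \<V>"
    and "(\<Sum>V\<in>#\<V>. f V) = c * size \<V> \<Longrightarrow> V \<in># \<V> \<Longrightarrow> f V = c"
proof -
  have le: "(\<forall>V \<in># M. f V \<le> c) \<Longrightarrow> (\<Sum>V\<in>#M. f V) \<le> c * size M" for M
    by (induction M) auto
  then show "(\<Sum>V\<in>#\<V>. f V) \<le> c * size \<V>" using assms by blast
  assume eq: "(\<Sum>V\<in>#\<V>. f V) = c * size \<V>" and V: "V \<in># \<V>"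
  then obtain M where M: "\<V> = add_mset V M" by (meson multi_member_split)
  have "(\<Sum>V\<in>#M. f V) \<le> c * size M" using le[of M] assms M by auto
  then show "f V = c" using eq assms M by auto
qed

lemma weight_ge_2:
  assumes "minimal_zero_sum V"
  shows "2 \<le> weight V"
proof (cases "0 \<in># V")
  case True
  then show ?thesis using zero_in_minimal_zero_sum[OF assms] by (simp add: weight_def)
next
  case False
  then have "size V \<noteq> 1" using zero_sum_size_1 assms by (auto simp: minimal_zero_sum_def)
  moreover have "size V \<noteq> 0" using assms by (auto simp: minimal_zero_sum_def)
  ultimately show ?thesis unfolding weight_def by linarith
qed

text \<open>
  An atom of weight \<open>2\<close> is \<open>{#0#}\<close> or \<open>{#x, - x#}\<close>.
\<close>

lemma weight_2_symmetric:
  assumes "minimal_zero_sum V" "weight V = 2"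
  shows "neg_seq V = V"
proof (cases "0 \<in># V")
  case True
  then show ?thesis using zero_in_minimal_zero_sum[OF assms(1)] by simp
next
  case False
  then have "size V = 2" using assms(2) by (simp add: weight_def not_in_iff)
  then obtain x M where M: "V = add_mset x M" "size M = 1"
    by (metis One_nat_def Suc_1 size_eq_Suc_imp_eq_union size_add_mset nat.inject)
  then obtain y where "V = {#x, y#}" using size_1_singleton_mset by blast
  moreover from this have "y = - x" using assms(1) by (simp add: minimal_zero_sum_def eq_neg_iff_add_eq_0 add.commute)
  ultimately show ?thesis by (simp add: add_mset_commute)
qed

lemma count_neg_seq: "count (neg_seq S) x = count S (- x :: 'a::ab_group_add)"
  by (induction S) auto

lemma set_elasticity_finite:
  assumes "finite L" "L \<noteq> {}" "0 \<notin> L"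
  shows "set_elasticity L = ereal (real (Max L) / real (Min L))"
proof -
  have "(SUP k\<in>L. ereal (real k)) = ereal (real (Max L))"
    using assms by (intro antisym SUP_least SUP_upper) auto
  moreover have "Inf L = Min L" using assms by (simp add: cInf_eq_Min)
  moreover have "Min L \<noteq> 0" using assms Min_in by metis
  moreover have "L \<noteq> {0}" using assms by auto
  ultimately show ?thesis unfolding set_elasticity_def by simp
qed

context class_map
begin

lemma weight_le:
  assumes "minimal_zero_sum V" "set_mset V \<subseteq> C"
  shows "weight V \<le> 2 * n + 2"
proof (cases "0 \<in># V")
  case True
  then show ?thesis using zero_in_minimal_zero_sum[OF assms(1)] by (simp add: weight_def)
next
  case False
  then show ?thesis using long_minimal_zero_sum_structure(1)[OF assms]
    by (cases "2 * n + 2 \<le> size V") (auto simp: weight_def not_in_iff)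
qed

lemma weight_eq_max:
  assumes "minimal_zero_sum V" "weight V = 2 * n + 2"
  shows "size V = 2 * n + 2"
proof -
  have "0 \<notin># V" using zero_in_minimal_zero_sum[OF assms(1)] assms(2) n_ge_2 by (auto simp: weight_def)
  then show ?thesis using assms(2) by (simp add: weight_def not_in_iff)
qed

lemma factors_over_C:
  assumes "\<Sum>\<^sub># \<V> = A" "set_mset A \<subseteq> C" "V \<in># \<V>"
  shows "set_mset V \<subseteq> C"
  using assms by auto

text \<open>
  Compare the weight of \<open>A\<close> in both factorizations: it is at least \<open>2 * l\<close> and at most \<open>(2 * n +
  2) * k\<close>.
\<close>

lemma lengths_ratio_le:
  assumes A: "set_mset A \<subseteq> C" and "k \<in> factorization_lengths A" "l \<in> factorization_lengths A"
  shows "l \<le> (n + 1) * k"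
proof -
  obtain \<U> where U: "size \<U> = k" "\<forall>V \<in># \<U>. minimal_zero_sum V" "\<Sum>\<^sub># \<U> = A"
    using assms(2) by (rule factorization_lengthsE)
  obtain \<V> where V: "size \<V> = l" "\<forall>V \<in># \<V>. minimal_zero_sum V" "\<Sum>\<^sub># \<V> = A"
    using assms(3) by (rule factorization_lengthsE)
  have "2 * size \<V> \<le> (\<Sum>V\<in>#\<V>. weight V)"
    using V weight_ge_2 by (intro sum_mset_ge_const) auto
  moreover have "(\<Sum>V\<in>#\<U>. weight V) \<le> (2 * n + 2) * size \<U>"
    using U weight_le factors_over_C[OF U(3) A] by (intro sum_mset_le_const) auto
  moreover have "(\<Sum>V\<in>#\<V>. weight V) = (\<Sum>V\<in>#\<U>. weight V)"
    using U(3) V(3) by (simp flip: weight_Union)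
  ultimately show ?thesis using U(1) V(1) by simp
qed

lemma set_elasticity_lengths:
  assumes A: "set_mset A \<subseteq> C" "sum_mset A = 0"
  shows "set_elasticity (factorization_lengths A) \<le> ereal (real (n + 1))"
    and "set_elasticity (factorization_lengths A) = ereal (real (n + 1)) \<longleftrightarrow>
      A \<noteq> {#} \<and> Max (factorization_lengths A) = (n + 1) * Min (factorization_lengths A)"
proof -
  let ?L = "factorization_lengths A"
  show "set_elasticity ?L \<le> ereal (real (n + 1))"
    and "set_elasticity ?L = ereal (real (n + 1)) \<longleftrightarrow> A \<noteq> {#} \<and> Max ?L = (n + 1) * Min ?L"
  proof (atomize (full), cases "A = {#}")
    case True
    have "?L = {0}" using factorization_lengths_le_size[of _ A] factorization_lengths_empty True by auto
    then have "set_elasticity ?L = 1" by (simp add: set_elasticity_def)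
    then show "set_elasticity ?L \<le> ereal (real (n + 1)) \<and>
        (set_elasticity ?L = ereal (real (n + 1)) \<longleftrightarrow> A \<noteq> {#} \<and> Max ?L = (n + 1) * Min ?L)"
      using True n_ge_2 by (simp add: one_ereal_def)
  next
    case False
    have L: "finite ?L" "?L \<noteq> {}" "0 \<notin> ?L"
      using finite_factorization_lengths factorization_exists[OF A(2)] zero_in_factorization_lengths_iff False
      by auto
    have "Min ?L \<in> ?L" "Max ?L \<in> ?L" using L by auto
    then have le: "Max ?L \<le> (n + 1) * Min ?L" using lengths_ratio_le[OF A(1)] by blast
    have pos: "real (Min ?L) > 0" using \<open>Min ?L \<in> ?L\<close> L(3) by (metis gr0I of_nat_0_less_iff)
    have "real (Max ?L) \<le> real (n + 1) * real (Min ?L)" using le by (metis of_nat_le_iff of_nat_mult)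
    moreover have "real (Max ?L) = real (n + 1) * real (Min ?L) \<longleftrightarrow> Max ?L = (n + 1) * Min ?L"
      by (metis of_nat_eq_iff of_nat_mult)
    ultimately show "set_elasticity ?L \<le> ereal (real (n + 1)) \<and>
        (set_elasticity ?L = ereal (real (n + 1)) \<longleftrightarrow> A \<noteq> {#} \<and> Max ?L = (n + 1) * Min ?L)"
      using set_elasticity_finite[OF L] pos False by (simp add: divide_le_eq divide_eq_eq)
  qed
qed

text \<open>
  Equality in \<open>lengths_ratio_le\<close> forces every factor to have the extremal weight.
\<close>

lemma extremal_factorization:
  assumes A: "set_mset A \<subseteq> C" and "k \<in> factorization_lengths A" "(n + 1) * k \<in> factorization_lengths A"
  obtains \<U> where "size \<U> = k" "\<Sum>\<^sub># \<U> = A"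
    "\<forall>U \<in># \<U>. minimal_zero_sum U \<and> set_mset U \<subseteq> C \<and> size U = 2 * n + 2" "neg_seq A = A"
proof -
  obtain \<U> where U: "size \<U> = k" "\<forall>V \<in># \<U>. minimal_zero_sum V" "\<Sum>\<^sub># \<U> = A"
    using assms(2) by (rule factorization_lengthsE)
  obtain \<V> where V: "size \<V> = (n + 1) * k" "\<forall>V \<in># \<V>. minimal_zero_sum V" "\<Sum>\<^sub># \<V> = A"
    using assms(3) by (rule factorization_lengthsE)
  have V2: "\<forall>V \<in># \<V>. 2 \<le> weight V" using V weight_ge_2 by auto
  have UC: "\<forall>V \<in># \<U>. weight V \<le> 2 * n + 2" using U weight_le factors_over_C[OF U(3) A] by auto
  have eq: "(\<Sum>V\<in>#\<V>. weight V) = (\<Sum>V\<in>#\<U>. weight V)"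
    using U(3) V(3) by (simp flip: weight_Union)
  have "2 * size \<V> = (2 * n + 2) * size \<U>" using U(1) V(1) by simp
  with sum_mset_ge_const(1)[OF V2] sum_mset_le_const(1)[OF UC] eq
  have sums: "(\<Sum>V\<in>#\<V>. weight V) = 2 * size \<V>" "(\<Sum>V\<in>#\<U>. weight V) = (2 * n + 2) * size \<U>"
    by linarith+
  have "\<forall>U \<in># \<U>. minimal_zero_sum U \<and> set_mset U \<subseteq> C \<and> size U = 2 * n + 2"
    using U(2) weight_eq_max factors_over_C[OF U(3) A] sum_mset_le_const(2)[OF UC sums(2)] by blast
  moreover have "neg_seq (\<Sum>\<^sub># \<V>) = \<Sum>\<^sub># \<V>"
  proof -
    have "\<forall>V \<in># \<V>. neg_seq V = V"
      using V(2) weight_2_symmetric sum_mset_ge_const(2)[OF V2 sums(1)] by blast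
    then show ?thesis by (induction \<V>) auto
  qed
  ultimately show ?thesis using that U(1,3) V(3) by metis
qed

text \<open>
  If a factorization into atoms of length \<open>2 n + 2\<close> has more than three times as many factors as
  there are such atoms, then some atom \<open>U\<close> occurs in it four times. Since \<open>A\<close> equals its negative,
  it contains two copies of \<open>U\<close> together with two copies of \<open>- U\<close>, and differences of lengths of a
  part of these persist in \<open>A\<close>.
\<close>

lemma extremal_lengths_difference:
  assumes fin: "finite C" and A: "set_mset A \<subseteq> C"
    and k: "k \<in> factorization_lengths A" "(n + 1) * k \<in> factorization_lengths A"
    and large: "k > 3 * card {U. minimal_zero_sum U \<and> set_mset U \<subseteq> C \<and> size U = 2 * n + 2}"
    and d: "\<And>i j. i \<in> factorization_lengths A \<Longrightarrow> j \<in> factorization_lengths A \<Longrightarrow> int d dvd int i - int j"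
  shows "d = 1"
proof -
  let ?M = "{U. minimal_zero_sum U \<and> set_mset U \<subseteq> C \<and> size U = 2 * n + 2}"
  obtain \<U> where U: "size \<U> = k" "\<Sum>\<^sub># \<U> = A"
      "\<forall>U \<in># \<U>. minimal_zero_sum U \<and> set_mset U \<subseteq> C \<and> size U = 2 * n + 2"
    and sym: "neg_seq A = A"
    by (rule extremal_factorization[OF A k])
  then have UM: "set_mset \<U> \<subseteq> ?M" by blast
  have "?M \<subseteq> mset ` {xs. set xs \<subseteq> C \<and> length xs = 2 * n + 2}"
  proof
    fix U assume "U \<in> ?M"
    moreover obtain xs where "mset xs = U" using ex_mset by blast
    ultimately show "U \<in> mset ` {xs. set xs \<subseteq> C \<and> length xs = 2 * n + 2}" by force
  qed
  then have finM: "finite ?M" using finite_lists_length_eq[OF fin] finite_surj by blast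
  have "\<exists>U \<in># \<U>. 4 \<le> count \<U> U"
  proof (rule ccontr)
    assume "\<not> ?thesis"
    then have "size \<U> \<le> (\<Sum>U\<in>set_mset \<U>. 3)"
      unfolding size_multiset_overloaded_eq by (intro sum_mono) force
    also have "\<dots> \<le> 3 * card ?M" using card_mono[OF finM UM] by simp
    finally show False using large U(1) by simp
  qed
  then obtain U where "U \<in># \<U>" "4 \<le> count \<U> U" by blast
  then have U_max: "U \<in> ?M" and "replicate_mset 4 U \<subseteq># \<U>" using UM by (auto simp: count_le_replicate_mset_subset_eq)
  then obtain \<U>' where "\<U> = replicate_mset 4 U + \<U>'" by (metis mset_subset_eq_exists_conv)
  then have A4: "A = (U + U + (U + U)) + \<Sum>\<^sub># \<U>'" using U(2) by (simp add: eval_nat_numeral add.assoc)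
  have "U + U + neg_seq (U + U) \<subseteq># A"
  proof (rule mset_subset_eqI)
    fix x
    \<comment> \<open>Both \<open>4 * count U x\<close> and \<open>4 * count U (- x)\<close> are at most \<open>count A x\<close>, hence so is twice the sum of both counts.\<close>
    have "count A x = count A (- x)" using sym count_neg_seq by metis
    moreover have "4 * count U x \<le> count A x" "4 * count U (- x) \<le> count A (- x)" unfolding A4 by simp_all
    ultimately show "count (U + U + neg_seq (U + U)) x \<le> count A x" by (simp add: count_neg_seq)
  qed
  show ?thesis
  proof (rule long_minimal_zero_sum_difference[of U])
    fix E i j assume E: "E \<subseteq># U + U + neg_seq (U + U)"
      and ij: "i \<in> factorization_lengths E" "j \<in> factorization_lengths E"
    then obtain R where R: "A = E + R"
      using \<open>U + U + neg_seq (U + U) \<subseteq># A\<close> by (metis mset_subset_eq_exists_conv subset_mset.order_trans)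
    moreover have "sum_mset E = 0" "sum_mset A = 0"
      using factorization_lengths_zero_sum ij(1) k(1) by auto
    ultimately obtain r where "r \<in> factorization_lengths R" using factorization_exists[of R] by auto
    then have "i + r \<in> factorization_lengths A" "j + r \<in> factorization_lengths A"
      unfolding R using ij factorization_lengths_add by auto
    from d[OF this] show "int d dvd int i - int j" by simp
  qed (use U_max in auto)
qed

end

section \<open>Almost arithmetical progressions\<close>

lemma interval_at_top_AAP:
  fixes L :: "nat set"
  assumes "\<And>k. k \<in> L \<Longrightarrow> k \<le> y + m" and "\<And>i. i \<le> m \<Longrightarrow> y + i \<in> L"
  shows "is_AAP 1 m (int ` L)"
proof -
  define L' where "L' = (\<lambda>k. int k - int y) ` {k \<in> L. k < y}"
  have "int ` L = (\<lambda>z. int y + z) ` (L' \<union> {int i * int 1 | i. i \<le> m} \<union> {})" (is "_ = ?R")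
  proof (intro equalityI subsetI)
    fix z assume "z \<in> int ` L"
    then obtain k where k: "k \<in> L" "z = int k" by blast
    show "z \<in> ?R"
    proof (cases "k < y")
      case True
      then have "int k - int y \<in> L'" using k(1) by (auto simp: L'_def)
      then show ?thesis using k(2) by (intro image_eqI[of _ _ "int k - int y"]) auto
    next
      case False
      then have "z = int y + int (k - y) * int 1" "k - y \<le> m" using k assms(1)[OF k(1)] by auto
      then show ?thesis by blast
    qed
  next
    fix z assume "z \<in> ?R"
    then show "z \<in> int ` L"
      using assms(2) by (auto simp: L'_def image_iff) (metis of_nat_add)
  qed
  moreover have "finite L'" "L' \<subseteq> {- int y .. -1}" by (auto simp: L'_def)
  moreover have "int ` L \<subseteq> {int y + int 1 * z | z. True}"
    by (auto intro: exI[of _ "_ - int y"])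
  ultimately show ?thesis unfolding is_AAP_def
    by (intro conjI exI[of _ "int y"] exI[of _ L'] exI[of _ "{}"] exI[of _ y]) auto
qed

lemma is_AAP_progression:
  assumes "is_AAP d l L"
  obtains y where "d \<ge> 1" "\<And>i. i \<le> l \<Longrightarrow> y + int i * int d \<in> L"
    "\<And>u v. u \<in> L \<Longrightarrow> v \<in> L \<Longrightarrow> int d dvd u - v"
proof -
  obtain y L' L'' where d: "d \<ge> 1"
    and L: "L = (\<lambda>z. y + z) ` (L' \<union> {int i * int d | i. i \<le> l} \<union> L'')"
    and sub: "L \<subseteq> {y + int d * z | z. True}"
    using assms unfolding is_AAP_def by (elim conjE exE) (rule that)
  have "int d dvd u - v" if uv: "u \<in> L" "v \<in> L" for u v
  proof -
    obtain s where s: "u = y + int d * s" using sub uv(1) by blast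
    obtain t where t: "v = y + int d * t" using sub uv(2) by blast
    have "u - v = int d * (s - t)" by (simp add: s t algebra_simps)
    then show ?thesis by simp
  qed
  moreover have "y + int i * int d \<in> L" if "i \<le> l" for i unfolding L using that by blast
  ultimately show ?thesis using d that by blast
qed

section \<open>A long sequence with consecutive lengths\<close>

lemma submultiset_add_mset:
  assumes "W \<subseteq># add_mset x M"
  obtains b W' where "W = (if b then {#x#} else {#}) + W'" "W' \<subseteq># M"
proof (cases "W \<subseteq># M")
  case True
  then show ?thesis using that[of False W] by simp
next
  case False
  then have "x \<in># W" using assms by (metis diff_single_trivial insert_DiffM insert_subset_eq_iff subset_eq_diff_conv union_mset_add_mset_right add_0_right)
  then obtain W' where "W = add_mset x W'" by (meson multi_member_split)
  then show ?thesis using that[of True W'] assms by simp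
qed

text \<open>
  The elements \<open>p\<close>, \<open>q\<close>, \<open>f\<close> have orders \<open>2\<close>, \<open>2\<close>, \<open>2 * n\<close> and are independent.
\<close>

locale class_map_basis = class_map +
  fixes f p q :: 'a
  assumes finite_C: "finite C"
    and basis_C: "f \<in> C" "p \<in> C" "q \<in> C"
    and double_p: "p + p = 0" and double_q: "q + q = 0"
    and order_f: "sum_mset (replicate_mset (2 * n) f) = 0"
    and independent: "j \<le> 2 * n \<Longrightarrow>
      sum_mset (replicate_mset j f) + ((if a then p else 0) + (if b then q else 0)) = 0 \<Longrightarrow>
      \<not> a \<and> \<not> b \<and> (j = 0 \<or> j = 2 * n)"
begin

definition long_seq :: "'a multiset" where
  "long_seq = {#p, f + p, q, f + q#} + replicate_mset (2 * n - 2) f"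

lemma size_long_seq: "size long_seq = 2 * n + 2"
  using n_ge_2 by (simp add: long_seq_def)

lemma long_seq_C: "set_mset long_seq \<subseteq> C"
  using basis_C by (auto simp: long_seq_def add_C)

text \<open>
  By independence, a zero-sum subsequence contains both or none of \<open>p\<close>, \<open>f + p\<close>, and both or none
  of \<open>q\<close>, \<open>f + q\<close>. Its sum is then \<open>j\<close> times \<open>f\<close> for some \<open>j \<le> 2 * n\<close>, where \<open>j = 2 * n\<close> only for
  the whole sequence.
\<close>

lemma minimal_zero_sum_long_seq: "minimal_zero_sum long_seq"
  unfolding minimal_zero_sum_def
proof (intro conjI allI impI)
  show "long_seq \<noteq> {#}" by (simp add: long_seq_def)
  have "replicate_mset (2 * n) f = {#f, f#} + replicate_mset (2 * n - 2) f"
    using n_ge_2 by (intro multiset_eqI) auto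
  then have "f + (f + sum_mset (replicate_mset (2 * n - 2) f)) = 0" using order_f by simp
  moreover have "sum_mset long_seq = (p + p) + (q + q) + (f + (f + sum_mset (replicate_mset (2 * n - 2) f)))"
    by (simp add: long_seq_def add_ac)
  ultimately show "sum_mset long_seq = 0" by (simp add: double_p double_q)
next
  fix W assume W: "W \<subseteq># long_seq" "sum_mset W = 0"
  define s where "s = (\<lambda>(b::bool) (x::'a). if b then {#x#} else {#})"
  obtain b1 W1 where 1: "W = s b1 p + W1" "W1 \<subseteq># {#f + p, q, f + q#} + replicate_mset (2 * n - 2) f"
    using W(1) unfolding long_seq_def s_def by (auto elim: submultiset_add_mset)
  obtain b2 W2 where 2: "W1 = s b2 (f + p) + W2" "W2 \<subseteq># {#q, f + q#} + replicate_mset (2 * n - 2) f"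
    using 1(2) unfolding s_def by (auto elim: submultiset_add_mset)
  obtain b3 W3 where 3: "W2 = s b3 q + W3" "W3 \<subseteq># {#f + q#} + replicate_mset (2 * n - 2) f"
    using 2(2) unfolding s_def by (auto elim: submultiset_add_mset)
  obtain b4 W4 where 4: "W3 = s b4 (f + q) + W4" "W4 \<subseteq># replicate_mset (2 * n - 2) f"
    using 3(2) unfolding s_def by (auto elim: submultiset_add_mset)
  obtain i where i: "i \<le> 2 * n - 2" "W4 = replicate_mset i f"
    using 4(2) by (rule msubseteq_replicate_msetE)
  \<comment> \<open>The multiplicity of \<open>f\<close> in the sum of \<open>W\<close>: \<open>f + p\<close> and \<open>f + q\<close> contribute one \<open>f\<close> each.\<close>
  define j where "j = i + of_bool b2 + of_bool b4"
  have "sum_mset W = sum_mset (replicate_mset j f) + ((if b1 \<noteq> b2 then p else 0) + (if b3 \<noteq> b4 then q else 0))"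
    unfolding 1 2 3 4 i j_def s_def
    by (cases b1; cases b2; cases b3; cases b4)
      (simp_all add: add_ac double_p double_q flip: add.assoc[of p p] add.assoc[of q q])
  moreover have "j \<le> 2 * n" using i n_ge_2 by (auto simp: j_def)
  ultimately have b: "b1 = b2" "b3 = b4" "j = 0 \<or> j = 2 * n" using independent[of j] W(2) by auto
  from b(3) show "W = {#} \<or> W = long_seq"
  proof
    assume "j = 0"
    then have "\<not> b2" "\<not> b4" "i = 0" by (auto simp: j_def split: if_splits)
    then show ?thesis using b 1 2 3 4 i by (simp add: s_def)
  next
    assume "j = 2 * n"
    then have "b2" "b4" "i = 2 * n - 2" using i n_ge_2 by (auto simp: j_def of_bool_def split: if_splits)
    then show ?thesis using b 1 2 3 4 i by (simp add: s_def long_seq_def)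
  qed
qed

lemma zero_notin_long_seq: "0 \<notin># long_seq"
  using minimal_zero_sum_nonzero[OF minimal_zero_sum_long_seq] size_long_seq by simp

text \<open>
  The length \<open>2 * n + 1\<close> comes from \<open>f = p + (f + p)\<close>, by which three pairs \<open>x (-x)\<close> can be
  replaced by two atoms.
\<close>

lemma lengths_long_seq:
  "2 \<in> factorization_lengths (long_seq + neg_seq long_seq)"
  "2 * n + 1 \<in> factorization_lengths (long_seq + neg_seq long_seq)"
  "2 * n + 2 \<in> factorization_lengths (long_seq + neg_seq long_seq)"
proof -
  have "1 + 1 \<in> factorization_lengths (long_seq + neg_seq long_seq)"
    by (intro factorization_lengths_add minimal_zero_sum_length_1 minimal_zero_sum_neg minimal_zero_sum_long_seq)
  then show "2 \<in> factorization_lengths (long_seq + neg_seq long_seq)" by (simp only: one_add_one)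
  show "2 * n + 2 \<in> factorization_lengths (long_seq + neg_seq long_seq)"
    using factorization_lengths_pairs[OF zero_notin_long_seq] size_long_seq by simp
  let ?S = "{#f, p, f + p#}"
  let ?R = "{#q, f + q#} + replicate_mset (2 * n - 3) f"
  have "2 * n - 2 = Suc (2 * n - 3)" using n_ge_2 by simp
  then have U: "long_seq = ?S + ?R" unfolding long_seq_def by (simp add: add_mset_commute)
  have nz: "0 \<notin># ?S" "0 \<notin># ?R" using zero_notin_long_seq unfolding U by auto
  have "p + (f + p) = f + (p + p)" by (simp only: add_ac)
  then have "f = p + (f + p)" using double_p by simp
  from factorization_lengths_add[OF lengths_sum_of_two(1)[OF nz(1) this] factorization_lengths_pairs[OF nz(2)]]
  have "2 + size ?R \<in> factorization_lengths ((?S + neg_seq ?S) + (?R + neg_seq ?R))" .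
  moreover have "(?S + neg_seq ?S) + (?R + neg_seq ?R) = long_seq + neg_seq long_seq"
    unfolding U image_mset_union by (simp only: add_ac)
  moreover have "2 + size ?R = 2 * n + 1" using n_ge_2 by simp
  ultimately show "2 * n + 1 \<in> factorization_lengths (long_seq + neg_seq long_seq)" by argo
qed

text \<open>
  The maximal length is \<open>n + 1\<close> times the length \<open>2 * m\<close>, so the bound on ratios makes \<open>2 * m\<close> the
  minimal length. Near the maximum, every copy of \<open>long_seq + neg_seq long_seq\<close> contributes
  either \<open>2 * n + 1\<close> or \<open>2 * n + 2\<close>.
\<close>

lemma lengths_long_seq_powers:
  fixes m :: nat
  assumes "m \<ge> 1"
  defines "A \<equiv> repeat_mset m (long_seq + neg_seq long_seq)"
  shows "set_mset A \<subseteq> C" "sum_mset A = 0"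
    and "Min (factorization_lengths A) = 2 * m"
    and "Max (factorization_lengths A) = (2 * n + 2) * m"
    and "i \<le> m \<Longrightarrow> (2 * n + 1) * m + i \<in> factorization_lengths A"
proof -
  let ?S = "long_seq + neg_seq long_seq"
  have "set_mset (repeat_mset j ?S) \<subseteq> set_mset ?S" for j by (induction j) auto
  moreover have "set_mset ?S \<subseteq> C" using long_seq_C neg_C by auto
  ultimately show C: "set_mset A \<subseteq> C" unfolding A_def by blast
  have two: "2 * m \<in> factorization_lengths A"
    using factorization_lengths_repeat[OF lengths_long_seq(1), of m] by (simp add: A_def mult.commute)
  have top: "(2 * n + 2) * m \<in> factorization_lengths A"
    using factorization_lengths_repeat[OF lengths_long_seq(3), of m] by (simp add: A_def mult.commute)
  show "sum_mset A = 0" using factorization_lengths_zero_sum[OF two] .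
  have "2 * m \<le> k" if "k \<in> factorization_lengths A" for k
  proof -
    have "(n + 1) * (2 * m) \<le> (n + 1) * k" using lengths_ratio_le[OF C that top] by (simp add: algebra_simps)
    then show ?thesis by (simp only: mult_le_cancel1)
  qed
  then show "Min (factorization_lengths A) = 2 * m"
    using two finite_factorization_lengths by (intro Min_eqI) auto
  have "k \<le> (2 * n + 2) * m" if "k \<in> factorization_lengths A" for k
    using lengths_ratio_le[OF C two that] by (simp add: algebra_simps)
  then show "Max (factorization_lengths A) = (2 * n + 2) * m"
    using top finite_factorization_lengths by (intro Max_eqI) auto
  assume i: "i \<le> m"
  have "(m - i) * (2 * n + 1) + i * (2 * n + 2) \<in>
      factorization_lengths (repeat_mset (m - i) ?S + repeat_mset i ?S)"
    by (intro factorization_lengths_add factorization_lengths_repeat lengths_long_seq)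
  moreover obtain j where j: "m = j + i" using i by (metis le_add_diff_inverse2)
  have "repeat_mset (m - i) ?S + repeat_mset i ?S = A"
    unfolding A_def j by (rule multiset_eqI) (simp add: algebra_simps)
  moreover have "(m - i) * (2 * n + 1) + i * (2 * n + 2) = (2 * n + 1) * m + i"
    unfolding j by (simp add: algebra_simps)
  ultimately show "(2 * n + 1) * m + i \<in> factorization_lengths A" by (simp only:)
qed

text \<open>
  The long intervals of lengths above show that \<open>1\<close> belongs to \<open>\<Delta>\<^sub>\<rho>\<close> and that the elasticity is \<open>n
  + 1\<close>. For arbitrary \<open>d\<close> in \<open>\<Delta>\<^sub>\<rho>\<close>, a long progression has a large maximum, hence also a large
  minimum because the ratio is \<open>n + 1\<close>, and \<open>extremal_lengths_difference\<close> applies.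
\<close>

theorem Delta_rho_eq:
  fixes H :: "('h, 'c) monoid_scheme"
  assumes system: "length_system H = factorization_lengths ` {A. set_mset A \<subseteq> C \<and> sum_mset A = 0}"
  shows "Delta_rho H = {1}"
proof -
  have long: "\<exists>A. set_mset A \<subseteq> C \<and> sum_mset A = 0 \<and> is_AAP 1 m (int ` factorization_lengths A) \<and>
      set_elasticity (factorization_lengths A) = ereal (real (n + 1))" if "m \<ge> 1" for m
  proof -
    let ?A = "repeat_mset m (long_seq + neg_seq long_seq)"
    note A = lengths_long_seq_powers[OF that]
    have "is_AAP 1 m (int ` factorization_lengths ?A)"
    proof (rule interval_at_top_AAP)
      show "k \<le> (2 * n + 1) * m + m" if "k \<in> factorization_lengths ?A" for k
        using Max_ge[OF finite_factorization_lengths that] A(4) by (simp add: algebra_simps)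
    qed (rule A(5))
    moreover have "?A \<noteq> {#}" using that by (simp add: long_seq_def)
    then have "set_elasticity (factorization_lengths ?A) = ereal (real (n + 1))"
      unfolding set_elasticity_lengths(2)[OF A(1,2)] using A(3,4) by (simp add: algebra_simps)
    ultimately show ?thesis using A(1,2) by blast
  qed
  have elasticity: "elasticity H = ereal (real (n + 1))"
    unfolding elasticity_def system
  proof (rule antisym)
    show "(SUP L\<in>factorization_lengths ` {A. set_mset A \<subseteq> C \<and> sum_mset A = 0}. set_elasticity L)
        \<le> ereal (real (n + 1))"
      using set_elasticity_lengths(1) by (auto intro!: SUP_least)
    obtain A where "set_mset A \<subseteq> C" "sum_mset A = 0"
      "set_elasticity (factorization_lengths A) = ereal (real (n + 1))" using long[of 1] by auto
    then show "ereal (real (n + 1)) \<le>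
        (SUP L\<in>factorization_lengths ` {A. set_mset A \<subseteq> C \<and> sum_mset A = 0}. set_elasticity L)"
      by (intro SUP_upper2[of "factorization_lengths A"]) auto
  qed
  show ?thesis
  proof (intro equalityI subsetI)
    fix d assume d: "d \<in> Delta_rho H"
    define N where "N = card {U. minimal_zero_sum U \<and> set_mset U \<subseteq> C \<and> size U = 2 * n + 2}"
    define K where "K = (n + 1) * (3 * N + 1)"
    have "K \<ge> 1" by (simp add: K_def)
    then have "\<exists>L\<in>length_system H. \<exists>l\<ge>K. is_AAP d l (int ` L) \<and> set_elasticity L = ereal (real (n + 1))"
      using d unfolding Delta_rho_def elasticity by simp
    then obtain L l where L: "L \<in> length_system H" "K \<le> l"
      "is_AAP d l (int ` L)" "set_elasticity L = ereal (real (n + 1))" by blast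
    obtain A where A: "set_mset A \<subseteq> C" "sum_mset A = 0" "L = factorization_lengths A"
      using L(1) unfolding system by blast
    obtain y where d1: "d \<ge> 1" and mem: "\<And>i. i \<le> l \<Longrightarrow> y + int i * int d \<in> int ` L"
      and diff: "\<And>u v. u \<in> int ` L \<Longrightarrow> v \<in> int ` L \<Longrightarrow> int d dvd u - v"
      using is_AAP_progression[OF L(3)] by metis
    have "0 \<le> y" using mem[of 0] by auto
    obtain x where x: "x \<in> L" "int x = y + int l * int d" using mem[of l] by force
    have "int l \<le> int l * int d" using d1 by (simp add: mult_le_cancel_left1)
    then have "l \<le> x" using x(2) \<open>0 \<le> y\<close> by linarith
    have max: "Max L = (n + 1) * Min L"
      using L(4) set_elasticity_lengths(2)[OF A(1,2)] A(3) by simp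
    have fin: "finite L" "L \<noteq> {}" using A(3) finite_factorization_lengths x(1) by auto
    have "K \<le> (n + 1) * Min L"
      using L(2) \<open>l \<le> x\<close> Max_ge[OF fin(1) x(1)] max by linarith
    then have large: "3 * N < Min L" unfolding K_def mult_le_cancel1 by simp
    have "Min L \<in> L" "Max L \<in> L" using fin by auto
    moreover have "int d dvd int i - int j" if "i \<in> L" "j \<in> L" for i j
      using diff that by blast
    ultimately have "d = 1"
      using max A(3) by (intro extremal_lengths_difference[OF finite_C A(1) _ _ large[unfolded N_def]]) auto
    then show "d \<in> {1}" by simp
  next
    fix d :: nat assume "d \<in> {1}"
    moreover have "\<exists>L\<in>length_system H. \<exists>l\<ge>k. is_AAP 1 l (int ` L) \<and> set_elasticity L = elasticity H"
      if "k \<ge> 1" for k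
      using long[OF that] unfolding system elasticity by blast
    ultimately show "d \<in> Delta_rho H" unfolding Delta_rho_def by simp
  qed
qed

end

section \<open>The group \<open>\<rat>/\<int>\<close>\<close>

text \<open>
  One type of class \<open>ab_group_add\<close> that contains cyclic groups of all finite orders.
\<close>

quotient_type rat_mod_int = rat / "\<lambda>x y. x - y \<in> \<int>"
proof (rule equivpI)
  show "reflp (\<lambda>x y :: rat. x - y \<in> \<int>)" by (rule reflpI) simp
  show "symp (\<lambda>x y :: rat. x - y \<in> \<int>)" by (rule sympI) (metis Ints_minus minus_diff_eq)
  show "transp (\<lambda>x y :: rat. x - y \<in> \<int>)" 
  proof (rule transpI)
    fix x y z :: rat assume "x - y \<in> \<int>" "y - z \<in> \<int>"
    then have "(x - y) + (y - z) \<in> \<int>" by (rule Ints_add)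
    then show "x - z \<in> \<int>" by simp
  qed
qed

instantiation rat_mod_int :: ab_group_add
begin

lift_definition zero_rat_mod_int :: rat_mod_int is 0 .

lift_definition plus_rat_mod_int :: "rat_mod_int \<Rightarrow> rat_mod_int \<Rightarrow> rat_mod_int" is "(+)"
proof -
  fix a b c d :: rat assume "a - b \<in> \<int>" "c - d \<in> \<int>"
  then have "(a - b) + (c - d) \<in> \<int>" by (rule Ints_add)
  then show "(a + c) - (b + d) \<in> \<int>" by (simp add: algebra_simps)
qed

lift_definition uminus_rat_mod_int :: "rat_mod_int \<Rightarrow> rat_mod_int" is uminus
proof -
  fix a b :: rat assume "a - b \<in> \<int>"
  then have "- (a - b) \<in> \<int>" by (rule Ints_minus)
  then show "- a - - b \<in> \<int>" by simp
qed

lift_definition minus_rat_mod_int :: "rat_mod_int \<Rightarrow> rat_mod_int \<Rightarrow> rat_mod_int" is "(-)"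
proof -
  fix a b c d :: rat assume "a - b \<in> \<int>" "c - d \<in> \<int>"
  then have "(a - b) - (c - d) \<in> \<int>" by (rule Ints_diff)
  then show "(a - c) - (b - d) \<in> \<int>" by (simp add: algebra_simps)
qed

instance
  by standard (transfer; simp)+

end

lift_definition mod_int :: "rat \<Rightarrow> rat_mod_int" is "\<lambda>x. x" .

lemma mod_int_add: "mod_int (x + y) = mod_int x + mod_int y"
  by transfer simp

lemma mod_int_eq_0_iff: "mod_int x = 0 \<longleftrightarrow> x \<in> \<int>"
  by transfer simp

instance bit :: finite
proof
  have "(UNIV :: bit set) = {0, 1}" by (auto intro: bit.exhaust)
  then show "finite (UNIV :: bit set)" by (metis finite.emptyI finite_insert)
qed

section \<open>The group \<open>C\<^sub>2 \<oplus> C\<^sub>2 \<oplus> C\<^sub>2\<^sub>n\<close>\<close>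

text \<open>
  The class of a point is kept as an extra coordinate: the third bit is the parity of the
  coordinate \<open>c\<close>, although it is determined by the last component. In this way the class map is
  simply \<open>fst\<close>, which is additive on the whole type.
\<close>

type_synonym coordinates = "(bit \<times> bit \<times> bit) \<times> rat_mod_int"

definition point :: "nat \<Rightarrow> int \<Rightarrow> int \<Rightarrow> int \<Rightarrow> coordinates" where
  "point n a b c = ((of_int a, of_int b, of_int c), mod_int (of_int c / of_nat (2 * n)))"

lemma point_add: "point n a b c + point n a' b' c' = point n (a + a') (b + b') (c + c')"
  by (simp add: point_def add_divide_distrib mod_int_add)

lemma of_int_bit_eq_0_iff: "(of_int a :: bit) = 0 \<longleftrightarrow> even a"
proof -
  have "(of_int (2 * (a div 2) + a mod 2) :: bit) = of_int (a mod 2)"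
    by (simp only: of_int_add of_int_mult) simp
  then have "(of_int a :: bit) = of_int (a mod 2)" by simp
  then show ?thesis by (cases "even a") (simp_all add: even_iff_mod_2_eq_zero odd_iff_mod_2_eq_one)
qed

lemma point_eq_0_iff:
  assumes "n \<ge> 1"
  shows "point n a b c = 0 \<longleftrightarrow> even a \<and> even b \<and> int (2 * n) dvd c"
proof -
  have "(of_int c / of_nat (2 * n) :: rat) \<in> \<int> \<longleftrightarrow> int (2 * n) dvd c"
  proof
    assume "(of_int c / of_nat (2 * n) :: rat) \<in> \<int>"
    then obtain k where "(of_int c / of_nat (2 * n) :: rat) = of_int k" by (rule Ints_cases)
    then have "(of_int c :: rat) = of_int (int (2 * n) * k)" using assms by (simp add: field_simps)
    then have "c = int (2 * n) * k" by (simp only: of_int_eq_iff)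
    then show "int (2 * n) dvd c" by simp
  next
    assume "int (2 * n) dvd c"
    then obtain k where "c = int (2 * n) * k" by blast
    then have "(of_int c / of_nat (2 * n) :: rat) = of_int k" using assms by simp
    then show "(of_int c / of_nat (2 * n) :: rat) \<in> \<int>" by simp
  qed
  moreover have "int (2 * n) dvd c \<Longrightarrow> even c" by (metis dvd_trans dvd_triv_left of_nat_mult of_nat_numeral)
  ultimately show ?thesis
    by (auto simp: point_def zero_prod_def mod_int_eq_0_iff of_int_bit_eq_0_iff)
qed

lemma point_minus: "- point n a b c = point n (- a) (- b) (- c)"
proof -
  have "point n a b c + point n (- a) (- b) (- c) = point n 0 0 0" by (simp add: point_add)
  also have "\<dots> = 0" by (simp add: point_def zero_prod_def mod_int_eq_0_iff)
  finally show ?thesis by (rule minus_unique)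
qed

lemma point_eq_iff:
  assumes "n \<ge> 1"
  shows "point n a b c = point n a' b' c' \<longleftrightarrow>
    even (a - a') \<and> even (b - b') \<and> int (2 * n) dvd c - c'"
proof -
  have "point n a b c = point n a' b' c' \<longleftrightarrow> point n a b c + - point n a' b' c' = 0" 
    by (simp only: add_eq_0_iff2 minus_minus)
  then show ?thesis using assms by (simp add: point_minus point_add point_eq_0_iff)
qed

lemma point_mod:
  assumes "n \<ge> 1"
  shows "point n (a mod 2) (b mod 2) (c mod int (2 * n)) = point n a b c"
  unfolding point_eq_iff[OF assms]
  by (metis dvd_minus_mod dvd_minus_iff minus_diff_eq)

lemma sum_replicate_point: "sum_mset (replicate_mset j (point n 0 0 1)) = point n 0 0 (int j)"
proof (induction j)
  case 0
  show ?case by (simp add: point_def zero_prod_def mod_int_eq_0_iff)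
next
  case (Suc j)
  then show ?case by (simp add: point_add)
qed

definition points :: "nat \<Rightarrow> coordinates set" where
  "points n = {point n a b c | a b c. True}"

lemma point_in_points: "point n a b c \<in> points n"
  unfolding points_def by blast

lemma points_eq_image:
  assumes "n \<ge> 1"
  shows "points n = (\<lambda>(a, b, c). point n a b c) ` ({0..<2} \<times> {0..<2} \<times> {0..<int (2 * n)})"
proof (intro equalityI subsetI)
  fix x assume "x \<in> points n"
  then obtain a b c where "x = point n a b c" by (auto simp: points_def)
  then have "x = (\<lambda>(a, b, c). point n a b c) (a mod 2, b mod 2, c mod int (2 * n))"
    using point_mod[OF assms] by simp
  moreover have "(a mod 2, b mod 2, c mod int (2 * n)) \<in> {0..<2} \<times> {0..<2} \<times> {0..<int (2 * n)}"
    using assms by simp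
  ultimately show "x \<in> (\<lambda>(a, b, c). point n a b c) ` ({0..<2} \<times> {0..<2} \<times> {0..<int (2 * n)})"
    by (rule image_eqI)
qed (auto simp: points_def)

lemma card_points_kernel:
  assumes "n \<ge> 1"
  shows "card {x \<in> points n. fst x = 0} = n"
proof -
  have "{x \<in> points n. fst x = 0} = (\<lambda>i. point n 0 0 (2 * int i)) ` {..<n}"
  proof (intro equalityI subsetI)
    fix x assume "x \<in> {x \<in> points n. fst x = 0}"
    then obtain a b c where x: "x = point n a b c" "even a" "even b" "even c"
      by (auto simp: points_def point_def zero_prod_def of_int_bit_eq_0_iff)
    define i where "i = nat ((c mod int (2 * n)) div 2)"
    have "even (c mod int (2 * n))" using x(4) by (simp add: dvd_mod)
    moreover have "0 \<le> c mod int (2 * n)" "c mod int (2 * n) < int (2 * n)" using assms by simp_all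
    ultimately have "2 * int i = c mod int (2 * n)" "i < n" by (auto simp: i_def)
    moreover from this(1) have "x = point n 0 0 (2 * int i)"
      using x point_mod[OF assms, of a b c] by simp
    ultimately show "x \<in> (\<lambda>i. point n 0 0 (2 * int i)) ` {..<n}" by blast
  next
    fix x assume "x \<in> (\<lambda>i. point n 0 0 (2 * int i)) ` {..<n}"
    then obtain i where x: "x = point n 0 0 (2 * int i)" by blast
    have "x \<in> points n" unfolding x points_def by blast
    moreover have "fst x = 0" by (simp add: x point_def zero_prod_def)
    ultimately show "x \<in> {x \<in> points n. fst x = 0}" by simp
  qed
  moreover have "inj_on (\<lambda>i. point n 0 0 (2 * int i)) {..<n}"
  proof (rule inj_onI)
    fix i j assume ij: "i \<in> {..<n}" "j \<in> {..<n}" "point n 0 0 (2 * int i) = point n 0 0 (2 * int j)"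
    then have "2 * int n dvd 2 * (int i - int j)" using assms by (simp add: point_eq_iff right_diff_distrib)
    then have "int n dvd int i - int j" by (metis dvd_mult_cancel_left zero_neq_numeral)
    moreover have "\<bar>int i - int j\<bar> < int n" using ij by auto
    ultimately have "int i - int j = 0" using zdvd_not_zless by (metis abs_of_nat dvd_imp_le_int not_less)
    then show "i = j" by simp
  qed
  ultimately show ?thesis by (simp add: card_image)
qed

lemma card_bit_cubed: "card (UNIV :: (bit \<times> bit \<times> bit) set) = 8"
proof -
  have "(UNIV :: bit set) = {0, 1}" by (auto intro: bit.exhaust)
  then have "card (UNIV :: bit set) = 2" by (metis card_2_iff zero_neq_one)
  then show ?thesis by (simp add: card_cartesian_product flip: UNIV_Times_UNIV)
qed

lemma class_map_basis_points:
  assumes "n \<ge> 2"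
  shows "class_map_basis (points n) fst n (point n 0 0 1) (point n 1 0 0) (point n 0 1 0)"
proof unfold_locales
  have n1: "n \<ge> 1" using assms by simp
  have zero: "point n 0 0 0 = 0" by (simp add: point_eq_0_iff[OF n1])
  show "n \<ge> 2" by fact
  show "0 \<in> points n" using point_in_points[of n 0 0 0] by (simp only: zero)
  show "x + y \<in> points n" if xy: "x \<in> points n" "y \<in> points n" for x y
  proof -
    obtain a b c a' b' c' where "x = point n a b c" "y = point n a' b' c'"
      using xy unfolding points_def by blast
    then show ?thesis by (simp add: point_add point_in_points)
  qed
  show "- x \<in> points n" if x: "x \<in> points n" for x
  proof -
    obtain a b c where "x = point n a b c" using x unfolding points_def by blast
    then show ?thesis by (simp add: point_minus point_in_points)
  qed
  show "fst (x + y) = fst x + fst y" for x y :: coordinates by (rule fst_add)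
  show "card {x \<in> points n. fst x = 0} = n" by (rule card_points_kernel[OF n1])
  show "v + v = 0" for v :: "bit \<times> bit \<times> bit" by (cases v) (simp add: zero_prod_def)
  show "card (UNIV :: (bit \<times> bit \<times> bit) set) = 8" by (rule card_bit_cubed)
  show "finite (points n)" unfolding points_eq_image[OF n1] by simp
  show "point n 0 0 1 \<in> points n" "point n 1 0 0 \<in> points n" "point n 0 1 0 \<in> points n"
    by (rule point_in_points)+
  show "point n 1 0 0 + point n 1 0 0 = 0" "point n 0 1 0 + point n 0 1 0 = 0"
    by (simp_all add: point_add point_eq_0_iff[OF n1])
  show "sum_mset (replicate_mset (2 * n) (point n 0 0 1)) = 0"
    by (simp add: sum_replicate_point point_eq_0_iff[OF n1])
  fix j :: nat and a b :: bool
  assume j: "j \<le> 2 * n" and sum: "sum_mset (replicate_mset j (point n 0 0 1)) +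
    ((if a then point n 1 0 0 else 0) + (if b then point n 0 1 0 else 0)) = 0"
  have "(if a then point n 1 0 0 else 0) + (if b then point n 0 1 0 else 0) = point n (of_bool a) (of_bool b) 0"
    by (auto simp: point_add zero)
  then have "point n (of_bool a) (of_bool b) (int j) = 0"
    using sum by (simp add: sum_replicate_point point_add)
  then have "\<not> a" "\<not> b" "int (2 * n) dvd int j" by (auto simp: point_eq_0_iff[OF n1])
  moreover from this(3) have "2 * n dvd j" by (simp only: int_dvd_int_iff)
  then have "j = 0 \<or> j = 2 * n" using j by (auto dest: dvd_imp_le)
  ultimately show "\<not> a \<and> \<not> b \<and> (j = 0 \<or> j = 2 * n)" by blast
qed

text \<open>
  Reducing the coordinates modulo \<open>2\<close>, \<open>2\<close> and \<open>2 * n\<close> does not change the point, so \<open>point\<close> turns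
  the operation of the direct product into addition.
\<close>

lemma embedding_into_points:
  fixes G :: "('g, 'b) monoid_scheme"
  assumes n: "n \<ge> 1" and G: "group G"
    and iso: "G \<cong> integer_mod_group 2 \<times>\<times> integer_mod_group 2 \<times>\<times> integer_mod_group (2 * n)"
  obtains e where "additive_embedding G e" "e ` carrier G = points n"
proof -
  let ?P = "integer_mod_group 2 \<times>\<times> integer_mod_group 2 \<times>\<times> integer_mod_group (2 * n)"
  obtain \<phi> where \<phi>: "\<phi> \<in> iso G ?P" using iso by (auto simp: is_iso_def)
  then have bij: "bij_betw \<phi> (carrier G) ({0..<2} \<times> {0..<2} \<times> {0..<int (2 * n)})"
    and hom: "\<phi> \<in> hom G ?P"
    using n by (auto simp: iso_def carrier_integer_mod_group)
  define w where "w = (\<lambda>(a, b, c). point n a b c)"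
  define e where "e = (\<lambda>x. w (\<phi> x))"
  have wP: "w (s \<otimes>\<^bsub>?P\<^esub> t) = w s + w t" for s t
    using point_mod[OF n] by (cases s; cases t) (simp add: w_def point_add)
  have inj_w: "inj_on w ({0..<2} \<times> {0..<2} \<times> {0..<int (2 * n)})"
  proof -
    have small: "x = y" if "m dvd x - y" "0 \<le> x" "x < m" "0 \<le> y" "y < m" for m x y :: int
      using that by (metis mod_eq_dvd_iff mod_pos_pos_trivial)
    show ?thesis
    proof (rule inj_onI)
      fix s t assume s: "s \<in> {0..<2} \<times> {0..<2} \<times> {0..<int (2 * n)}"
        and t: "t \<in> {0..<2} \<times> {0..<2} \<times> {0..<int (2 * n)}" and eq: "w s = w t"
      obtain a b c where abc: "s = (a, b, c)" by (cases s)
      obtain a' b' c' where abc': "t = (a', b', c')" by (cases t)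
      have "2 dvd a - a'" "2 dvd b - b'" "int (2 * n) dvd c - c'"
        using eq unfolding abc abc' w_def prod.case point_eq_iff[OF n] by blast+
      then have "a = a'" "b = b'" "c = c'"
        using s t small[of 2 a a'] small[of 2 b b'] small[of "int (2 * n)" c c'] by (auto simp: abc abc')
      then show "s = t" by (simp add: abc abc')
    qed
  qed
  have e_mult: "e (x \<otimes>\<^bsub>G\<^esub> y) = e x + e y" if "x \<in> carrier G" "y \<in> carrier G" for x y
    using that hom by (simp add: e_def hom_mult wP)
  have inj_e: "inj_on e (carrier G)"
    using comp_inj_on[of \<phi> "carrier G" w] bij inj_w by (simp add: e_def comp_def bij_betw_def)
  interpret group G by (rule G)
  have "comm_group G"
  proof (rule group_comm_groupI)
    fix x y assume xy: "x \<in> carrier G" "y \<in> carrier G"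
    then have "e (x \<otimes>\<^bsub>G\<^esub> y) = e (y \<otimes>\<^bsub>G\<^esub> x)" by (simp add: e_mult add.commute)
    then show "x \<otimes>\<^bsub>G\<^esub> y = y \<otimes>\<^bsub>G\<^esub> x" using inj_e xy by (auto dest: inj_onD)
  qed
  then have "additive_embedding G e"
    by (intro additive_embedding.intro additive_embedding_axioms.intro e_mult inj_e)
  moreover have "e ` carrier G = points n"
  proof -
    have "e ` carrier G = w ` \<phi> ` carrier G" by (simp add: e_def image_image)
    also have "\<dots> = w ` ({0..<2} \<times> {0..<2} \<times> {0..<int (2 * n)})"
      by (simp only: bij_betw_imp_surj_on[OF bij])
    finally show ?thesis by (simp only: w_def points_eq_image[OF n])
  qed
  ultimately show ?thesis by (rule that)
qed

theorem theorem3p9: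
  fixes G :: "('g, 'b) monoid_scheme"
    and H :: "('a, 'c) monoid_scheme"
    and n :: nat
  assumes "n \<ge> 2"
    and "group G"
    and "G \<cong> integer_mod_group 2 \<times>\<times> integer_mod_group 2 \<times>\<times> integer_mod_group (2 * n)"
    and "transfer_Krull_monoid H G"
  shows "Delta_rho H = {1}"
proof -
  have n1: "n \<ge> 1" using assms(1) by simp
  obtain e where e: "additive_embedding G e" "e ` carrier G = points n"
    by (rule embedding_into_points[OF n1 assms(2,3)])
  obtain \<theta> where "weak_transfer_hom H (zero_sum_monoid G) \<theta>"
    using assms(4) unfolding transfer_Krull_monoid_def by blast
  then have "length_system H = factorization_lengths ` {A. set_mset A \<subseteq> points n \<and> sum_mset A = 0}"
    by (rule additive_embedding.length_system_transfer[OF e(1), unfolded e(2)])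
  then show ?thesis
    by (rule class_map_basis.Delta_rho_eq[OF class_map_basis_points[OF assms(1)]])
qed

end
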